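(* Let $f=(\mathsf{x}(f),\mathsf{y}(f),\mathsf{t}(f))$ be a $C^2$-harmonic mapping defined on a domain $\Omega\subset\mathbb{R}^n$, with $\mathsf{x}(f)=H\circ\mathsf{y}(f)$ for a $C^2$ function $H$, such that $H'(s)\,H''(s)\le 0$ for all $s\in\mathbb{R}$. Then, for two concentric balls $B(0,r_1)\Subset B(0,r_2)\subset\mathbb{R}^n$ and the annular region between them, it holds for all $r_1<r<r_2$ that the component function $\mathsf{y}(f)$ satisfies $$M(r)\le M(r_1)\,\frac{r^{2-n}-r_2^{2-n}}{r_1^{2-n}-r_2^{2-n}}+M(r_2)\,\frac{r_1^{2-n}-r^{2-n}}{r_1^{2-n}-r_2^{2-n}},$$ where $M(r):=\sup_{|x|=r}\mathsf{y}(f)(x)$. The similar inequality (with $\mathsf{x}(f)$ in place of $\mathsf{y}(f)$ in the definition of $M$) holds for $\mathsf{x}(f)$ provided that $H''\ge 0$ in $\mathbb{R}$. Moreover, if $H$ satisfies the differential inequality $$\big(s+H(s)H'(s)\big)H''(s)\ge 0,$$ then the similar assertion holds for $\mathsf{t}(f)$.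
   Context: The first Heisenberg group $\mathbb{H}^1$ is $\mathbb{R}^3$ with coordinates $(\mathsf{x},\mathsf{y},\mathsf{t})$ and contact form $\theta=d\mathsf{t}+2(\mathsf{x}\,d\mathsf{y}-\mathsf{y}\,d\mathsf{x})$. Let $\Omega\subset\mathbb{R}^n$ be a domain. A harmonic curve (also called $C^2$-harmonic mapping) is a $C^2$ map $f=(\mathsf{x},\mathsf{y},\mathsf{t}):\Omega\to\mathbb{H}^1$ (components also written $\mathsf{x}(f),\mathsf{y}(f),\mathsf{t}(f)$), also written $f=(\mathsf{z},\mathsf{t})$ with $\mathsf{z}=\mathsf{x}+i\mathsf{y}$, such that: (1) (isotropicity) $\frac{\partial\mathsf{x}}{\partial x_\alpha}\frac{\partial\mathsf{y}}{\partial x_\beta}-\frac{\partial\mathsf{x}}{\partial x_\beta}\frac{\partial\mathsf{y}}{\partial x_\alpha}=0$ for all $\alpha<\beta$, and the contact condition $f^*\theta=0$ holds, i.e. $\nabla\mathsf{t}=2(\mathsf{y}\nabla\mathsf{x}-\mathsf{x}\nabla\mathsf{y})$; (2) (criticality) $f$ is a critical point of $E^2(f)=\int_\Omega|\nabla\mathsf{z}|^2dx$, where $|\nabla\mathsf{z}|^2=|\nabla\mathsf{x}|^2+|\nabla\mathsf{y}|^2$, with respect to domain variations $\mathsf{z}_s(x)=\mathsf{z}(x+s\xi(x))$, $\xi\in C_0^\infty(\Omega,\mathbb{R}^n)$. Harmonic curves are considered in the form $\mathsf{x}=H\circ\mathsf{y}$ with $H$ a $C^2$ function, and criticality is then expressed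 by the equation $$\Delta\mathsf{y}=-\frac{(H''\circ\mathsf{y})(H'\circ\mathsf{y})}{1+(H'\circ\mathsf{y})^2}|\nabla\mathsf{y}|^2\quad\text{in }\Omega.$$ $B(0,r)$ denotes the Euclidean ball of radius $r$ centered at the origin.
   Formalization: The dimension n = 2 is excluded, because there r^{2-n} is constantly 1 and the coefficients in the stated inequality are 0/0; all other n ≥ 1 are covered. *)

theory Defs
  imports "HOL-Analysis.Analysis"
begin

section \<open>Partial derivatives, gradients and classes of differentiability\<close>

text \<open>\<open>\<real>\<^sup>n\<close> is a type \<open>'a :: euclidean_space\<close> with \<open>n = DIM('a)\<close>; the coordinate directions are the
  elements of \<open>Basis\<close>.\<close>

definition partial :: "'a \<Rightarrow> ('a::euclidean_space \<Rightarrow> 'b::real_normed_vector) \<Rightarrow> 'a \<Rightarrow> 'b" where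
  "partial b u p = frechet_derivative u (at p) b"

definition grad :: "('a::euclidean_space \<Rightarrow> real) \<Rightarrow> 'a \<Rightarrow> 'a" where
  "grad u p = (\<Sum>b\<in>Basis. partial b u p *\<^sub>R b)"

text \<open>\<open>C\<^sup>k\<close> on an open set \<open>S\<close>. Since \<open>partial\<close> is unspecified where \<open>u\<close> is not differentiable,
  differentiability is required separately.\<close>

primrec Ck_on :: "nat \<Rightarrow> ('a::euclidean_space \<Rightarrow> 'b::real_normed_vector) \<Rightarrow> 'a set \<Rightarrow> bool" where
  "Ck_on 0 u S \<longleftrightarrow> continuous_on S u"
| "Ck_on (Suc k) u S \<longleftrightarrow>
     (\<forall>p\<in>S. u differentiable (at p)) \<and> (\<forall>b\<in>Basis. Ck_on k (partial b u) S)"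

definition supp :: "('a::euclidean_space \<Rightarrow> 'b::real_normed_vector) \<Rightarrow> 'a set" where
  "supp u = closure {p. u p \<noteq> 0}"

definition test_field :: "'a::euclidean_space set \<Rightarrow> ('a \<Rightarrow> 'a) \<Rightarrow> bool" where
  "test_field \<Omega> \<xi> \<longleftrightarrow> (\<forall>k. Ck_on k \<xi> UNIV) \<and> compact (supp \<xi>) \<and> supp \<xi> \<subseteq> \<Omega>"


section \<open>Harmonic maps into the first Heisenberg group\<close>

type_synonym heis = "real ^ 3"

definition xco :: "('a \<Rightarrow> heis) \<Rightarrow> 'a \<Rightarrow> real" where "xco f p = f p $ 1"
definition yco :: "('a \<Rightarrow> heis) \<Rightarrow> 'a \<Rightarrow> real" where "yco f p = f p $ 2"
definition tco :: "('a \<Rightarrow> heis) \<Rightarrow> 'a \<Rightarrow> real" where "tco f p = f p $ 3"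

definition zco :: "('a \<Rightarrow> heis) \<Rightarrow> 'a \<Rightarrow> complex" where
  "zco f p = Complex (xco f p) (yco f p)"

definition isotropic_on :: "'a::euclidean_space set \<Rightarrow> ('a \<Rightarrow> heis) \<Rightarrow> bool" where
  "isotropic_on \<Omega> f \<longleftrightarrow> (\<forall>p\<in>\<Omega>. \<forall>a\<in>Basis. \<forall>b\<in>Basis.
     partial a (xco f) p * partial b (yco f) p - partial b (xco f) p * partial a (yco f) p = 0)"

text \<open>\<open>f\<^sup>*\<theta> = 0\<close> for the contact form \<open>\<theta> = dt + 2(x dy - y dx)\<close>.\<close>

definition contact_on :: "'a::euclidean_space set \<Rightarrow> ('a \<Rightarrow> heis) \<Rightarrow> bool" where
  "contact_on \<Omega> f \<longleftrightarrow> (\<forall>p\<in>\<Omega>.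
     grad (tco f) p = 2 *\<^sub>R (yco f p *\<^sub>R grad (xco f) p - xco f p *\<^sub>R grad (yco f) p))"

definition grad_sq :: "('a::euclidean_space \<Rightarrow> complex) \<Rightarrow> 'a \<Rightarrow> real" where
  "grad_sq z p = (norm (grad (\<lambda>q. Re (z q)) p))\<^sup>2 + (norm (grad (\<lambda>q. Im (z q)) p))\<^sup>2"

definition energy :: "'a::euclidean_space set \<Rightarrow> ('a \<Rightarrow> complex) \<Rightarrow> real" where
  "energy A z = (LINT p:A|lebesgue. grad_sq z p)"

text \<open>Criticality of \<open>E\<^sup>2\<close> under the domain variations \<open>z\<^sub>s(p) = z(p + s \<xi>(p))\<close>. The energy over all
  of \<open>\<Omega>\<close> may be infinite (and the Bochner integral is then \<open>0\<close> by convention), so the derivative is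
  taken over the sets \<open>A\<close> of finite energy that carry the variation. If \<open>E\<^sup>2(f)\<close> is finite then
  \<open>A = \<Omega>\<close> is one of them; \<open>A = supp \<xi>\<close> always is when \<open>z\<close> is \<open>C\<^sup>1\<close>. The choice of \<open>A\<close> only changes
  the energy by a constant. For small \<open>s\<close> the point \<open>p + s \<xi>(p)\<close> stays in \<open>\<Omega>\<close>, so values of \<open>z\<close>
  outside \<open>\<Omega>\<close> play no role.\<close>

definition critical_on :: "'a::euclidean_space set \<Rightarrow> ('a \<Rightarrow> complex) \<Rightarrow> bool" where
  "critical_on \<Omega> z \<longleftrightarrow>
     (\<forall>\<xi> A. test_field \<Omega> \<xi> \<and> A \<in> sets lebesgue \<and> supp \<xi> \<subseteq> A \<and> A \<subseteq> \<Omega> \<and>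
        set_integrable lebesgue A (grad_sq z) \<longrightarrow>
        ((\<lambda>s. energy A (\<lambda>p. z (p + s *\<^sub>R \<xi> p))) has_real_derivative 0) (at 0))"

definition harmonic_map :: "'a::euclidean_space set \<Rightarrow> ('a \<Rightarrow> heis) \<Rightarrow> bool" where
  "harmonic_map \<Omega> f \<longleftrightarrow>
     Ck_on 2 f \<Omega> \<and> isotropic_on \<Omega> f \<and> contact_on \<Omega> f \<and> critical_on \<Omega> (zco f)"


section \<open>The three spheres inequality\<close>

definition sphere_sup :: "('a::euclidean_space \<Rightarrow> real) \<Rightarrow> real \<Rightarrow> real" where
  "sphere_sup u r = (SUP p\<in>sphere 0 r. u p)"

text \<open>For \<open>n = 2\<close> all denominators vanish, so this is meaningful for \<open>n \<noteq> 2\<close> only.\<close>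

definition three_spheres_ineq :: "('a::euclidean_space \<Rightarrow> real) \<Rightarrow> real \<Rightarrow> real \<Rightarrow> real \<Rightarrow> bool" where
  "three_spheres_ineq u r\<^sub>1 r r\<^sub>2 \<longleftrightarrow>
     (let e = 2 - int DIM('a); M = sphere_sup u in
      M r \<le> M r\<^sub>1 * ((r powi e - r\<^sub>2 powi e) / (r\<^sub>1 powi e - r\<^sub>2 powi e))
          + M r\<^sub>2 * ((r\<^sub>1 powi e - r powi e) / (r\<^sub>1 powi e - r\<^sub>2 powi e)))"

end

theory Submission
  imports Defs
begin

text \<open>
  Testing criticality with the fields \<open>\<phi> e\<close>, \<open>\<phi>\<close> a smooth bump function and \<open>e\<close> a coordinate
  direction, and integrating by parts, gives \<open>\<Delta>x \<nabla>x + \<Delta>y \<nabla>y = 0\<close>. With \<open>x = H \<circ> y\<close> this is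
  \<open>(1 + H'\<^sup>2) \<Delta>y = - H' H'' |\<nabla>y|\<^sup>2\<close>, from which \<open>(1 + H'\<^sup>2) \<Delta>x = H'' |\<nabla>y|\<^sup>2\<close> and, by the contact
  equation, \<open>(1 + H'\<^sup>2) \<Delta>t = 2 (y + H H') H'' |\<nabla>y|\<^sup>2\<close>. The sign conditions make the respective
  component subharmonic, and the maximum principle on the annulus compares it with the radial
  harmonic function \<open>\<alpha> + \<beta> |p|\<^bsup>2-n\<^esup>\<close> that takes the values \<open>M(r\<^sub>1)\<close> and \<open>M(r\<^sub>2)\<close> on the boundary.
\<close>

section \<open>Calculus of partial derivatives\<close>

text \<open>Domain variations are weaker than free variations of \<open>z\<close>: they do not give
  \<Delta>x = \<Delta>y = 0, only that the vector (\<Delta>x, \<Delta>y) is orthogonal to every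
  partial derivative of \<open>z\<close>. The relation \<open>x = H \<circ> y\<close> makes these
  partial derivatives proportional, so one scalar equation for \<open>y\<close> is left, and it
  degenerates where the gradient of \<open>y\<close> vanishes. As \<open>f\<close> is only
  \<open>C^2\<close>, no third derivative may occur. Therefore the gradient of the displaced map is
  computed before differentiating in \<open>s\<close>, and integration by parts is applied to
  products of first derivatives only; matching the two results takes the symmetry of continuous
  mixed second derivatives. The exponent \<open>2 - n\<close> is nonzero for
  \<open>n \<noteq> 2\<close>, so two radii give different values and \<alpha>, \<beta> can be
  fitted. This includes \<open>n = 1\<close>, where the radial function is
  \<open>\<alpha> + \<beta> |p|\<close>.\<close>

lemma partial_eqI: "(u has_derivative D) (at p) \<Longrightarrow> partial b u p = D b"
  unfolding partial_def by (metis frechet_derivative_at)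

lemma partial_cong_open:
  assumes "open S" "p \<in> S" "\<And>q. q \<in> S \<Longrightarrow> u q = v q" "u differentiable (at p)"
  shows "partial b u p = partial b v p"
  unfolding partial_def
  using frechet_derivative_transform_within_open[OF assms(4,1,2), of v] assms(3) by auto

lemma differentiable_cong_open:
  assumes "open S" "p \<in> S" "\<And>q. q \<in> S \<Longrightarrow> u q = v q" "u differentiable (at p)"
  shows "v differentiable (at p)"
  using assms has_derivative_transform_within_open unfolding differentiable_def by blast

text \<open>Derivatives of sums and composites are given by formulas valid only at points of
  \<open>S\<close>. As \<open>S\<close> is open, agreement on \<open>S\<close> passes to derivatives
  of every order, so the inductions below may replace a derivative by its formula.\<close>

lemma Ck_on_cong:
  assumes "open S" "\<And>q. q \<in> S \<Longrightarrow> u q = v q" "Ck_on k u S"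
  shows "Ck_on k v S"
  using assms(2,3)
proof (induction k arbitrary: u v)
  case 0
  then show ?case by (auto cong: continuous_on_cong)
next
  case (Suc k)
  have "Ck_on k (partial b v) S" if "b \<in> Basis" for b
  proof (rule Suc.IH[of "partial b u"])
    show "partial b u q = partial b v q" if "q \<in> S" for q
      using partial_cong_open[OF assms(1) that Suc.prems(1)] Suc.prems(2) that by simp
  qed (use Suc.prems that in auto)
  moreover have "v differentiable (at p)" if "p \<in> S" for p
    using differentiable_cong_open[OF assms(1) that Suc.prems(1)] Suc.prems(2) that by simp
  ultimately show ?case by simp
qed

lemma partial_bounded_linear:
  assumes "bounded_linear L" "u differentiable (at p)"
  shows "partial b (\<lambda>q. L (u q)) p = L (partial b u p)"
  using bounded_linear.has_derivative[OF assms(1) assms(2)[unfolded frechet_derivative_works]]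
  by (intro partial_eqI[THEN trans]) (auto simp: partial_def)

lemma Ck_on_bounded_linear:
  assumes "open S" "bounded_linear L" "Ck_on k u S"
  shows "Ck_on k (\<lambda>p. L (u p)) S"
  using assms(3)
proof (induction k arbitrary: u)
  case 0
  then show ?case
    using assms(2) by (auto intro: bounded_linear.continuous_on)
next
  case (Suc k)
  have "Ck_on k (partial b (\<lambda>p. L (u p))) S" if "b \<in> Basis" for b
    using Suc.prems that
    by (intro Ck_on_cong[OF \<open>open S\<close> _ Suc.IH[of "partial b u"]])
       (auto simp: partial_bounded_linear[OF assms(2)])
  moreover have "(\<lambda>p. L (u p)) differentiable (at p)" if "p \<in> S" for p
    using Suc.prems that bounded_linear.has_derivative[OF assms(2)]
    unfolding differentiable_def Ck_on.simps by blast
  ultimately show ?case by auto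
qed

lemma Ck_on_add:
  assumes "open S" "Ck_on k u S" "Ck_on k v S"
  shows "Ck_on k (\<lambda>p. u p + v p) S"
  using assms(2,3)
proof (induction k arbitrary: u v)
  case 0
  then show ?case by (auto intro: continuous_intros)
next
  case (Suc k)
  have "Ck_on k (partial b (\<lambda>p. u p + v p)) S" if "b \<in> Basis" for b
  proof (rule Ck_on_cong[OF \<open>open S\<close> _ Suc.IH[of "partial b u" "partial b v"]])
    show "partial b u q + partial b v q = partial b (\<lambda>p. u p + v p) q" if "q \<in> S" for q
      using Suc.prems that
      by (intro partial_eqI[THEN trans, symmetric])
         (auto simp: partial_def frechet_derivative_works intro!: has_derivative_add)
  qed (use Suc.prems that in auto)
  then show ?case using Suc.prems by auto
qed

lemma Ck_on_2D:
  assumes "Ck_on 2 u S"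
  shows "\<And>p. p \<in> S \<Longrightarrow> u differentiable (at p)"
    and "\<And>p b. p \<in> S \<Longrightarrow> b \<in> Basis \<Longrightarrow> partial b u differentiable (at p)"
    and "\<And>b c. b \<in> Basis \<Longrightarrow> c \<in> Basis \<Longrightarrow> continuous_on S (partial c (partial b u))"
  using assms by (auto simp: numeral_2_eq_2)

lemma differentiable_imp_continuous_on_open:
  "(\<And>p. p \<in> S \<Longrightarrow> u differentiable (at p)) \<Longrightarrow> continuous_on S u"
  by (meson continuous_at_imp_continuous_on differentiable_imp_continuous_within)

lemma partial_mult:
  fixes u v :: "'a::euclidean_space \<Rightarrow> real"
  assumes "u differentiable (at p)" "v differentiable (at p)"
  shows "partial b (\<lambda>q. u q * v q) p = partial b u p * v p + u p * partial b v p"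
  using assms unfolding frechet_derivative_works
  by (intro partial_eqI[THEN trans, OF has_derivative_mult]) (auto simp: partial_def)

text \<open>The factor \<open>c\<close> serves displacements \<open>\<phi> p *\<^sub>R e\<close> at
  a fixed point \<open>p\<close>, where \<open>c\<close> is \<open>\<phi> p\<close>; motion along a
  coordinate direction is the case \<open>c = 1\<close>.\<close>

lemma has_real_derivative_line:
  fixes u :: "'a::euclidean_space \<Rightarrow> real"
  assumes "u differentiable (at (p + s *\<^sub>R (c *\<^sub>R b)))"
  shows "((\<lambda>s. u (p + s *\<^sub>R (c *\<^sub>R b))) has_real_derivative
           c * partial b u (p + s *\<^sub>R (c *\<^sub>R b))) (at s)"
proof -
  let ?D = "frechet_derivative u (at (p + s *\<^sub>R (c *\<^sub>R b)))"
  have "((\<lambda>s. p + s *\<^sub>R (c *\<^sub>R b)) has_derivative (\<lambda>h. h *\<^sub>R (c *\<^sub>R b))) (at s)"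
    by (auto intro!: derivative_eq_intros)
  from has_derivative_compose[OF this, of u ?D] assms
  have "((\<lambda>s. u (p + s *\<^sub>R (c *\<^sub>R b))) has_derivative (\<lambda>h. ?D (h *\<^sub>R (c *\<^sub>R b)))) (at s)"
    by (auto simp: frechet_derivative_works)
  moreover have "?D (h *\<^sub>R (c *\<^sub>R b)) = (c * ?D b) * h" for h
    using linear_frechet_derivative[OF assms] by (simp add: linear_scale)
  ultimately show ?thesis by (auto simp: has_field_derivative_def partial_def)
qed

text \<open>The mean value theorem is applied twice: in direction \<open>a\<close> to a difference
  of \<open>u\<close> in direction \<open>b\<close>, then in direction \<open>b\<close> to
  \<open>partial a u\<close>. The second difference itself is symmetric in \<open>a\<close> and
  \<open>b\<close>, which makes the mixed derivatives comparable.\<close>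

lemma second_difference_mean_value:
  fixes u :: "'a::euclidean_space \<Rightarrow> real"
  assumes "0 < h"
    and in_S: "\<And>s t. 0 \<le> s \<Longrightarrow> s \<le> h \<Longrightarrow> 0 \<le> t \<Longrightarrow> t \<le> h \<Longrightarrow> p + s *\<^sub>R a + t *\<^sub>R b \<in> S"
    and "\<And>q. q \<in> S \<Longrightarrow> u differentiable (at q)"
    and "\<And>q. q \<in> S \<Longrightarrow> partial a u differentiable (at q)"
  obtains s t where "0 < s" "s < h" "0 < t" "t < h"
    "u (p + h *\<^sub>R a + h *\<^sub>R b) - u (p + h *\<^sub>R a) - u (p + h *\<^sub>R b) + u p
      = h * h * partial b (partial a u) (p + s *\<^sub>R a + t *\<^sub>R b)"
proof -
  define g where "g s = u (p + h *\<^sub>R b + s *\<^sub>R a) - u (p + s *\<^sub>R a)" for s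
  have g: "(g has_real_derivative
      partial a u (p + h *\<^sub>R b + s *\<^sub>R a) - partial a u (p + s *\<^sub>R a)) (at s)"
    if "0 \<le> s" "s \<le> h" for s
    unfolding g_def
    using has_real_derivative_line[of u "p + h *\<^sub>R b" s 1 a] has_real_derivative_line[of u p s 1 a]
      in_S[of s h] in_S[of s 0] assms(1,3) that
    by (intro DERIV_diff) (auto simp: add_ac)
  obtain s where s: "0 < s" "s < h"
    "g h - g 0 = h * (partial a u (p + h *\<^sub>R b + s *\<^sub>R a) - partial a u (p + s *\<^sub>R a))"
    using MVT2[OF \<open>0 < h\<close> g] by auto
  have k: "((\<lambda>t. partial a u (p + s *\<^sub>R a + t *\<^sub>R b)) has_real_derivative
      partial b (partial a u) (p + s *\<^sub>R a + t *\<^sub>R b)) (at t)" if "0 \<le> t" "t \<le> h" for t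
    using has_real_derivative_line[of "partial a u" "p + s *\<^sub>R a" t 1 b] in_S[of s t] assms(4) that s
    by auto
  obtain t where t: "0 < t" "t < h"
    "partial a u (p + s *\<^sub>R a + h *\<^sub>R b) - partial a u (p + s *\<^sub>R a + 0 *\<^sub>R b)
      = h * partial b (partial a u) (p + s *\<^sub>R a + t *\<^sub>R b)"
    using MVT2[OF \<open>0 < h\<close> k] by auto
  show ?thesis
  proof (rule that[OF s(1,2) t(1,2)])
    have "u (p + h *\<^sub>R a + h *\<^sub>R b) - u (p + h *\<^sub>R a) - u (p + h *\<^sub>R b) + u p = g h - g 0"
      by (simp add: g_def add_ac)
    also have "\<dots> = h * (partial a u (p + s *\<^sub>R a + h *\<^sub>R b) - partial a u (p + s *\<^sub>R a + 0 *\<^sub>R b))"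
      using s(3) by (simp add: add_ac)
    finally show "u (p + h *\<^sub>R a + h *\<^sub>R b) - u (p + h *\<^sub>R a) - u (p + h *\<^sub>R b) + u p
      = h * h * partial b (partial a u) (p + s *\<^sub>R a + t *\<^sub>R b)"
      using t(3) by simp
  qed
qed

lemma partial_commute:
  fixes u :: "'a::euclidean_space \<Rightarrow> real"
  assumes "open S" "p \<in> S" "Ck_on 2 u S" "a \<in> Basis" "b \<in> Basis"
  shows "partial a (partial b u) p = partial b (partial a u) p"
proof (rule ccontr)
  let ?A = "partial a (partial b u)" and ?B = "partial b (partial a u)"
  assume ne: "?A p \<noteq> ?B p"
  note u = Ck_on_2D[OF assms(3)]
  \<comment> \<open>Half the gap: the \<open>e\<close>-neighbourhoods of the two values are
    disjoint, while the symmetric second difference produces a number lying in both.\<close>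
  define e where "e = \<bar>?A p - ?B p\<bar> / 2"
  have "e > 0" using ne by (simp add: e_def)
  have "isCont ?A p" "isCont ?B p"
    using u(3) assms continuous_on_eq_continuous_at by blast+
  then obtain d1 d2 where d: "d1 > 0" "d2 > 0"
    "\<And>q. dist q p < d1 \<Longrightarrow> dist (?A q) (?A p) < e" "\<And>q. dist q p < d2 \<Longrightarrow> dist (?B q) (?B p) < e"
    using \<open>e > 0\<close> unfolding continuous_at_eps_delta by metis
  obtain d3 where d3: "d3 > 0" "ball p d3 \<subseteq> S"
    using assms(1,2) openE by blast
  \<comment> \<open>Points of the parallelogram lie within \<open>2 * h\<close> of \<open>p\<close>,
    so a third of the smallest radius suffices.\<close>
  define h where "h = min d1 (min d2 d3) / 3"
  have h: "h > 0" "2 * h < d1" "2 * h < d2" "2 * h < d3"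
    using d d3 by (auto simp: h_def min_def)
  have near: "dist (p + s *\<^sub>R a + t *\<^sub>R b) p \<le> 2 * h" if "0 \<le> s" "s \<le> h" "0 \<le> t" "t \<le> h" for s t
    using norm_triangle_ineq[of "s *\<^sub>R a" "t *\<^sub>R b"] that assms(4,5)
    by (auto simp: dist_norm add.assoc)
  have in_S: "p + s *\<^sub>R a + t *\<^sub>R b \<in> S" if "0 \<le> s" "s \<le> h" "0 \<le> t" "t \<le> h" for s t
    using near[OF that] h d3 by (auto simp: subset_eq dist_commute)
  have in_S': "p + s *\<^sub>R b + t *\<^sub>R a \<in> S" if "0 \<le> s" "s \<le> h" "0 \<le> t" "t \<le> h" for s t
    using in_S[of t s] that by (simp add: add_ac)
  obtain s t where st: "0 < s" "s < h" "0 < t" "t < h"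
    "u (p + h *\<^sub>R a + h *\<^sub>R b) - u (p + h *\<^sub>R a) - u (p + h *\<^sub>R b) + u p
      = h * h * ?B (p + s *\<^sub>R a + t *\<^sub>R b)"
    using second_difference_mean_value[OF h(1), of p a b S u] in_S u(1,2) assms(4) by blast
  obtain s' t' where st': "0 < s'" "s' < h" "0 < t'" "t' < h"
    "u (p + h *\<^sub>R b + h *\<^sub>R a) - u (p + h *\<^sub>R b) - u (p + h *\<^sub>R a) + u p
      = h * h * ?A (p + s' *\<^sub>R b + t' *\<^sub>R a)"
    using second_difference_mean_value[OF h(1), of p b a S u] in_S' u(1,2) assms(5) by blast
  have "u (p + h *\<^sub>R b + h *\<^sub>R a) = u (p + h *\<^sub>R a + h *\<^sub>R b)"
    by (simp add: add_ac)
  then have "h * h * ?B (p + s *\<^sub>R a + t *\<^sub>R b) = h * h * ?A (p + s' *\<^sub>R b + t' *\<^sub>R a)"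
    using st(5) st'(5) by linarith
  moreover have "p + s' *\<^sub>R b + t' *\<^sub>R a = p + t' *\<^sub>R a + s' *\<^sub>R b"
    by (simp add: add_ac)
  ultimately have "h * h * ?B (p + s *\<^sub>R a + t *\<^sub>R b) = h * h * ?A (p + t' *\<^sub>R a + s' *\<^sub>R b)"
    by simp
  then have "?B (p + s *\<^sub>R a + t *\<^sub>R b) = ?A (p + t' *\<^sub>R a + s' *\<^sub>R b)"
    using h(1) by simp
  moreover have "dist (?B (p + s *\<^sub>R a + t *\<^sub>R b)) (?B p) < e"
    using near[of s t] st h by (intro d) auto
  moreover have "dist (?A (p + t' *\<^sub>R a + s' *\<^sub>R b)) (?A p) < e"
    using near[of t' s'] st' h by (intro d) auto
  ultimately show False
    unfolding e_def dist_real_def by (auto simp: abs_if field_simps split: if_splits)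
qed

lemma norm_grad_sq:
  fixes u :: "'a::euclidean_space \<Rightarrow> real"
  shows "(norm (grad u p))\<^sup>2 = (\<Sum>b\<in>Basis. (partial b u p)\<^sup>2)"
proof -
  have "grad u p \<bullet> b = partial b u p" if "b \<in> Basis" for b
    using that unfolding grad_def by (rule inner_sum_left_Basis)
  then show ?thesis
    unfolding power2_norm_eq_inner euclidean_inner[of "grad u p" "grad u p"]
    by (simp add: power2_eq_square)
qed


section \<open>Smooth bump functions\<close>

text \<open>\<open>flat 0\<close> is the classical smooth function that is not analytic at
  \<open>0\<close>. Its derivatives leave \<open>flat 0\<close> but stay in the span of the whole
  family, which is why the powers in the denominator are included.\<close>

definition flat :: "nat \<Rightarrow> real \<Rightarrow> real" where
  "flat k x = (if 0 < x then exp (- 1 / x) / x ^ k else 0)"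

text \<open>Substituting \<open>inverse x\<close> reduces the limit from the right to exponential
  growth beating every power.\<close>

lemma flat_tendsto_0: "(flat k \<longlongrightarrow> 0) (at 0)"
proof -
  have "((\<lambda>x. inverse x ^ k / exp (inverse x)) \<longlongrightarrow> (0::real)) (at_right 0)"
    by (rule filterlim_compose[OF tendsto_power_div_exp_0 filterlim_inverse_at_top_right])
  then have "(flat k \<longlongrightarrow> 0) (at_right 0)"
    by (rule filterlim_cong[OF refl refl, THEN iffD1, rotated])
       (auto simp: eventually_at_filter flat_def exp_minus field_simps inverse_eq_divide)
  moreover have "(flat k \<longlongrightarrow> 0) (at_left 0)"
    by (rule filterlim_cong[OF refl refl, THEN iffD1, rotated, OF tendsto_const])
       (auto simp: eventually_at_filter flat_def)
  ultimately show ?thesis by (simp add: filterlim_at_split)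
qed

lemma has_real_derivative_flat:
  "(flat k has_real_derivative flat (k + 2) x - k * flat (k + 1) x) (at x)"
proof (cases x "0::real" rule: linorder_cases)
  case less
  have "((\<lambda>_. 0) has_real_derivative 0) (at x)" by simp
  then have "(flat k has_real_derivative 0) (at x)"
    by (rule has_field_derivative_transform_within_open[where S="{..<0}"])
       (use less in \<open>auto simp: flat_def\<close>)
  then show ?thesis using less by (simp add: flat_def)
next
  case equal
  have "((\<lambda>h. flat (k + 1) h) \<longlongrightarrow> 0) (at 0)" by (rule flat_tendsto_0)
  \<comment> \<open>The difference quotient of \<open>flat k\<close> at \<open>0\<close> is
    \<open>flat (k + 1)\<close>.\<close>
  then have "((\<lambda>h. (flat k (0 + h) - flat k 0) / h) \<longlongrightarrow> 0) (at 0)"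
    by (rule filterlim_cong[OF refl refl, THEN iffD1, rotated])
       (auto simp: eventually_at_filter flat_def field_simps)
  then show ?thesis using equal by (simp add: DERIV_def) (simp add: flat_def)
next
  case greater
  have "((\<lambda>x. exp (- 1 / x) / x ^ k) has_real_derivative flat (k + 2) x - k * flat (k + 1) x) (at x)"
  proof (cases k)
    case 0
    then show ?thesis using greater
      by (auto intro!: derivative_eq_intros simp: flat_def field_simps power2_eq_square)
  next
    case (Suc j)
    have "j = 0 \<or> x * x ^ (j - Suc 0) = x ^ j"
      by (cases j) auto
    then show ?thesis using Suc greater
      by (auto intro!: derivative_eq_intros simp: flat_def field_simps power2_eq_square)
  qed
  then show ?thesis
    by (rule has_field_derivative_transform_within_open[where S="{0<..}"])
       (use greater in \<open>auto simp: flat_def\<close>)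
qed

text \<open>The induction carries a total derivative together with the polynomiality of its value at
  \<open>b\<close>. Closure under \<open>partial\<close> lets polynomials serve as coefficients in
  the smoothness proof that follows.\<close>

lemma partial_real_polynomial_function:
  assumes "real_polynomial_function q"
  shows "real_polynomial_function (partial b q)" and "q differentiable (at p)"
proof -
  have "\<exists>D. (\<forall>p. (q has_derivative D p) (at p)) \<and> real_polynomial_function (\<lambda>p. D p b)"
    using assms
  proof induction
    case (linear f)
    then show ?case
      by (intro exI[of _ "\<lambda>_. f"]) (auto intro: bounded_linear_imp_has_derivative)
  next
    case (const c)
    show ?case by (intro exI[of _ "\<lambda>_ _. 0"]) auto
  next
    case (add f g)
    then obtain F G where "\<forall>p. (f has_derivative F p) (at p)" "real_polynomial_function (\<lambda>p. F p b)"
      "\<forall>p. (g has_derivative G p) (at p)" "real_polynomial_function (\<lambda>p. G p b)"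
      by blast
    then show ?case
      by (intro exI[of _ "\<lambda>p v. F p v + G p v"]) (auto intro: has_derivative_add)
  next
    case (mult f g)
    then obtain F G where "\<forall>p. (f has_derivative F p) (at p)" "real_polynomial_function (\<lambda>p. F p b)"
      "\<forall>p. (g has_derivative G p) (at p)" "real_polynomial_function (\<lambda>p. G p b)"
      by blast
    with mult.hyps show ?case
      by (intro exI[of _ "\<lambda>p v. f p * G p v + F p v * g p"]) (auto intro!: has_derivative_mult)
  qed
  then obtain D where D: "\<And>p. (q has_derivative D p) (at p)" "real_polynomial_function (\<lambda>p. D p b)"
    by blast
  then have "partial b q = (\<lambda>p. D p b)"
    by (auto intro: partial_eqI)
  then show "real_polynomial_function (partial b q)" using D by simp
  show "q differentiable (at p)" using D unfolding differentiable_def by blast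
qed

text \<open>Products of a polynomial with \<open>flat j \<circ> \<rho>\<close> are closed under
  partial differentiation up to finite sums: each derivative is a sum of three such products, with
  \<open>j\<close> raised by at most two. Hence \<open>q\<close> and \<open>j\<close> stay arbitrary
  in the induction.\<close>

lemma Ck_on_polynomial_flat:
  fixes q \<rho> :: "'a::euclidean_space \<Rightarrow> real"
  assumes "real_polynomial_function q" "real_polynomial_function \<rho>"
  shows "Ck_on k (\<lambda>p. q p * flat j (\<rho> p)) UNIV"
  using assms(1)
proof (induction k arbitrary: q j)
  case (0 q)
  have "isCont (flat j) x" for x
    using has_real_derivative_flat DERIV_isCont by blast
  then have "continuous_on UNIV (flat j)"
    by (simp add: continuous_at_imp_continuous_on)
  moreover have "continuous_on UNIV q" "continuous_on UNIV \<rho>"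
    using 0 assms(2) partial_real_polynomial_function(2)
    by (blast intro: differentiable_imp_continuous_on_open)+
  ultimately show ?case
    by (auto intro!: continuous_intros intro: continuous_on_compose2[of UNIV "flat j"])
next
  case (Suc k q)
  have D: "((\<lambda>p. q p * flat j (\<rho> p)) has_derivative (\<lambda>v. q p *
      ((flat (j + 2) (\<rho> p) - j * flat (j + 1) (\<rho> p)) * frechet_derivative \<rho> (at p) v)
      + frechet_derivative q (at p) v * flat j (\<rho> p))) (at p)" for p
    using has_derivative_compose[of \<rho> "frechet_derivative \<rho> (at p)" p UNIV "flat j"]
      has_real_derivative_flat[of j "\<rho> p"] partial_real_polynomial_function(2)[OF assms(2)]
      partial_real_polynomial_function(2)[OF Suc.prems]
    by (intro has_derivative_mult) (auto simp: frechet_derivative_works has_field_derivative_def)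
  have "partial b (\<lambda>p. q p * flat j (\<rho> p)) = (\<lambda>p. (q p * partial b \<rho> p) * flat (j + 2) (\<rho> p)
      + ((- real j) * (q p * partial b \<rho> p) * flat (j + 1) (\<rho> p) + partial b q p * flat j (\<rho> p)))" for b
    using partial_eqI[OF D] by (auto simp: fun_eq_iff partial_def algebra_simps)
  moreover have "Ck_on k (\<lambda>p. (q p * partial b \<rho> p) * flat (j + 2) (\<rho> p)
      + ((- real j) * (q p * partial b \<rho> p) * flat (j + 1) (\<rho> p) + partial b q p * flat j (\<rho> p))) UNIV" for b
    using Suc.prems assms(2) 
    by (intro Ck_on_add Suc.IH real_polynomial_function.intros(4) real_polynomial_function.intros(2)
          partial_real_polynomial_function) auto
  ultimately show ?case
    using D by (auto simp: differentiable_def)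
qed

text \<open>The squared norm makes the argument of \<open>flat 0\<close> a polynomial, so smoothness
  extends to the centre, where the norm itself is not differentiable.\<close>

definition bump :: "'a::euclidean_space \<Rightarrow> real \<Rightarrow> 'a \<Rightarrow> real" where
  "bump c r p = flat 0 (r\<^sup>2 - (norm (p - c))\<^sup>2)"

lemma bump_bounds: "0 \<le> bump c r p" "bump c r p \<le> 1"
  by (auto simp: bump_def flat_def)

lemma bump_center: "r > 0 \<Longrightarrow> bump c r c > 0"
  by (auto simp: bump_def flat_def)

lemma bump_eq_0: "r > 0 \<Longrightarrow> p \<notin> cball c r \<Longrightarrow> bump c r p = 0"
  by (auto simp: bump_def flat_def dist_norm norm_minus_commute not_less intro!: power_mono)

lemma Ck_on_bump: "Ck_on k (bump c r) UNIV"
proof -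
  have "real_polynomial_function (\<lambda>p::'a. r\<^sup>2 - (\<Sum>b\<in>Basis. (p \<bullet> b - c \<bullet> b) * (p \<bullet> b - c \<bullet> b)))"
    by (intro real_polynomial_function_diff real_polynomial_function_sum
          real_polynomial_function.intros(4) real_polynomial_function.intros(2))
       (auto intro: real_polynomial_function.intros(1) bounded_linear_inner_left)
  from Ck_on_polynomial_flat[OF real_polynomial_function.intros(2)[of 1] this, of k 0]
  show ?thesis
    unfolding bump_def[abs_def] power2_norm_eq_inner
    by (subst euclidean_inner) (simp add: inner_diff_left)
qed

lemma test_field_bump:
  assumes "r > 0" "cball c r \<subseteq> \<Omega>"
  shows "test_field \<Omega> (\<lambda>p. bump c r p *\<^sub>R e)" and "supp (\<lambda>p. bump c r p *\<^sub>R e) \<subseteq> cball c r"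
proof -
  show *: "supp (\<lambda>p. bump c r p *\<^sub>R e) \<subseteq> cball c r"
    unfolding supp_def
  proof (rule closure_minimal)
    show "{p. bump c r p *\<^sub>R e \<noteq> 0} \<subseteq> cball c r"
      using bump_eq_0[OF assms(1), of _ c] by fastforce
  qed simp
  have "compact (supp (\<lambda>p. bump c r p *\<^sub>R e))"
    using * by (metis bounded_cball bounded_subset closed_closure compact_eq_bounded_closed supp_def)
  then show "test_field \<Omega> (\<lambda>p. bump c r p *\<^sub>R e)"
    unfolding test_field_def using * assms(2)
    by (auto intro!: Ck_on_bounded_linear[OF _ bounded_linear_scaleR_left] Ck_on_bump)
qed

section \<open>The first variation of the Dirichlet integral\<close>

text \<open>\<open>S\<close> lies in the box and in its translate, so both sides equal the integral
  of \<open>V\<close> over the whole space.\<close>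

lemma integral_shift_supported:
  fixes V :: "'a::euclidean_space \<Rightarrow> real"
  assumes "\<And>p. p \<notin> S \<Longrightarrow> V p = 0" "S \<subseteq> cbox l m" "S \<subseteq> cbox (l + c) (m + c)"
  shows "integral (cbox l m) (\<lambda>p. V (p + c)) = integral (cbox l m) V"
proof -
  have V: "V = (\<lambda>p. if p \<in> T then V p else 0)" if "S \<subseteq> T" for T
    using assms(1) that by (intro ext) auto
  have "integral T V = integral UNIV V" if "S \<subseteq> T" for T
    using V[OF that] Henstock_Kurzweil_Integration.integral_restrict_UNIV[of T V] by simp
  moreover have "(\<lambda>p. V (p + c)) = V \<circ> (+) c"
    by (auto simp: add.commute)
  ultimately show ?thesis
    using assms(2,3) integral_shift_cbox_plus[of l m V c] by metis
qed

text \<open>The integral of \<open>\<phi> G\<close> over translates in the direction \<open>b\<close> is constant; differentiate.\<close>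

lemma integral_partial_supported:
  fixes \<phi> G :: "'a::euclidean_space \<Rightarrow> real"
  assumes "open \<Omega>" "0 < r" "cball c (2 * r) \<subseteq> cbox l m" "cbox l m \<subseteq> \<Omega>" and b: "b \<in> Basis"
    and \<phi>: "Ck_on 1 \<phi> UNIV" "\<And>p. p \<notin> cball c r \<Longrightarrow> \<phi> p = 0"
    and G: "\<And>p. p \<in> \<Omega> \<Longrightarrow> G differentiable (at p)" "continuous_on \<Omega> (partial b G)"
  shows "integral (cbox l m) (\<lambda>p. partial b \<phi> p * G p + \<phi> p * partial b G p) = 0"
proof -
  define V where "V p = \<phi> p * G p" for p
  define V' where "V' p = partial b \<phi> p * G p + \<phi> p * partial b G p" for p
  have in_\<Omega>: "cball c r \<subseteq> \<Omega>"
    using assms(2-4) by force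
  have zero: "partial b \<phi> p = 0" if "p \<notin> cball c r" for p
  proof -
    have "partial b \<phi> p = partial b (\<lambda>_. 0) p"
      using that \<phi> by (intro partial_cong_open[of "- cball c r"]) auto
    then show ?thesis by (simp add: partial_def)
  qed
  \<comment> \<open>\<open>G\<close> is arbitrary outside \<open>\<Omega>\<close>, but every point
    there has a neighbourhood on which \<open>\<phi>\<close> is zero. The product is thus
    differentiable on the whole space and can be translated freely.\<close>
  have V: "V differentiable (at p) \<and> partial b V p = V' p" for p
  proof (cases "p \<in> \<Omega>")
    case True
    then show ?thesis
      using \<phi>(1) G(1) unfolding V_def[abs_def] V'_def by (auto simp: partial_mult)
  next
    case False
    have p: "p \<in> - cball c r" using False in_\<Omega> by blast
    have "(V has_derivative (\<lambda>_. 0)) (at p)"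
      by (rule has_derivative_transform_within_open[of "\<lambda>_. 0" _ p UNIV "- cball c r"])
         (use p \<phi>(2) in \<open>auto simp: V_def\<close>)
    then show ?thesis
      using partial_eqI p zero[of p] \<phi>(2)[of p] unfolding differentiable_def V'_def by fastforce
  qed
  have contV: "continuous_on T V" for T
    using V by (blast intro: differentiable_imp_continuous_on_open)
  have "continuous_on \<Omega> V'"
    unfolding V'_def
  proof (intro continuous_intros)
    show "continuous_on \<Omega> \<phi>" "continuous_on \<Omega> G"
      using \<phi>(1) G(1) by (auto intro: differentiable_imp_continuous_on_open)
    show "continuous_on \<Omega> (partial b \<phi>)" "continuous_on \<Omega> (partial b G)"
      using \<phi>(1) G(2) b by (auto intro: continuous_on_subset)
  qed
  moreover have "continuous_on (- cball c r) V'"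
    by (rule continuous_on_eq[OF continuous_on_const[of _ 0]]) (simp add: zero \<phi>(2) V'_def)
  ultimately have "continuous_on (\<Omega> \<union> - cball c r) V'"
    using assms(1) by (intro continuous_on_open_Un) auto
  then have contV': "continuous_on UNIV V'"
    using in_\<Omega> by (auto elim: continuous_on_subset)
  let ?J = "\<lambda>s. integral (cbox l m) (\<lambda>p. V (p + s *\<^sub>R b))"
  have J: "(?J has_real_derivative integral (cbox l m) (\<lambda>p. V' (p + 0 *\<^sub>R b))) (at 0 within UNIV)"
  proof (rule leibniz_rule_field_derivative)
    show "((\<lambda>s. V (p + s *\<^sub>R b)) has_real_derivative V' (p + s *\<^sub>R b)) (at s within UNIV)" for s p
      using has_real_derivative_line[of V p s 1 b] V by simp
    show "(\<lambda>p. V (p + s *\<^sub>R b)) integrable_on cbox l m" for s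
      by (intro integrable_continuous continuous_on_compose2[OF contV[of UNIV]] continuous_intros) auto
    show "continuous_on (UNIV \<times> cbox l m) (\<lambda>(s, p). V' (p + s *\<^sub>R b))"
      unfolding split_beta by (intro continuous_on_compose2[OF contV'] continuous_intros) auto
  qed auto
  \<comment> \<open>This is the source of the radius \<open>2 * r\<close>: the margin
    \<open>r\<close> around the support keeps it inside the box under translations by less than
    \<open>r\<close>.\<close>
  have const: "?J s = integral (cbox l m) V" if "s \<in> {-r<..<r}" for s
  proof (rule integral_shift_supported)
    show "cball c r \<subseteq> cbox l m" using assms(2,3) by force
    show "cball c r \<subseteq> cbox (l + s *\<^sub>R b) (m + s *\<^sub>R b)"
    proof
      fix p assume "p \<in> cball c r"
      then have "p - s *\<^sub>R b \<in> cball c (2 * r)"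
        using norm_triangle_ineq[of "c - p" "s *\<^sub>R b"] that b by (auto simp: dist_norm algebra_simps)
      then have "p - s *\<^sub>R b \<in> cbox l m" using assms(3) by blast
      then show "p \<in> cbox (l + s *\<^sub>R b) (m + s *\<^sub>R b)"
        by (auto simp: mem_box algebra_simps)
    qed
  qed (use \<phi>(2) in \<open>auto simp: V_def\<close>)
  have "(?J has_real_derivative 0) (at 0)"
    by (rule has_field_derivative_transform_within_open[OF DERIV_const, of "{-r<..<r}"])
       (use const \<open>0 < r\<close> in auto)
  then have "integral (cbox l m) (\<lambda>p. V' (p + 0 *\<^sub>R b)) = 0"
    by (rule DERIV_unique[OF J])
  then show ?thesis by (simp add: V'_def)
qed

text \<open>Differentiation under the integral over a compact box, justified by joint continuity of
  the integrand's derivative. Taking the gradient by the chain rule first means that only second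
  derivatives of \<open>u\<close> appear; \<open>stay\<close> keeps the displaced points where
  \<open>u\<close> is \<open>C^2\<close>.\<close>

lemma first_variation:
  fixes u \<phi> :: "'a::euclidean_space \<Rightarrow> real"
  assumes "open \<Omega>" "0 < r" "cbox l m \<subseteq> \<Omega>" and e: "e \<in> Basis"
    and u: "Ck_on 2 u \<Omega>" and \<phi>: "Ck_on 1 \<phi> UNIV"
    and stay: "\<And>s p. \<bar>s\<bar> \<le> r \<Longrightarrow> p \<in> cbox l m \<Longrightarrow> p + s *\<^sub>R (\<phi> p *\<^sub>R e) \<in> cbox l m"
  shows "\<And>s. \<bar>s\<bar> \<le> r \<Longrightarrow>
      continuous_on (cbox l m) (\<lambda>p. (norm (grad (\<lambda>q. u (q + s *\<^sub>R (\<phi> q *\<^sub>R e))) p))\<^sup>2)"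
    and "((\<lambda>s. integral (cbox l m) (\<lambda>p. (norm (grad (\<lambda>q. u (q + s *\<^sub>R (\<phi> q *\<^sub>R e))) p))\<^sup>2))
      has_real_derivative integral (cbox l m) (\<lambda>p. \<Sum>b\<in>Basis. 2 * partial b u p *
        (\<phi> p * partial e (partial b u) p + partial b \<phi> p * partial e u p))) (at 0)"
proof -
  note u2 = Ck_on_2D[OF u]
  define \<Phi> where "\<Phi> s p = p + s *\<^sub>R (\<phi> p *\<^sub>R e)" for s p
  \<comment> \<open>\<open>g b s\<close> is the derivative of \<open>u\<close> after the
    displacement \<open>\<Phi> s\<close> in direction \<open>b\<close>, by the chain rule, and
    \<open>g'\<close> is its derivative in \<open>s\<close>. At \<open>s = 0\<close> they become
    \<open>partial b u\<close> and the bracket of the conclusion.\<close>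
  define g where "g b s p = partial b u (\<Phi> s p) + s * partial b \<phi> p * partial e u (\<Phi> s p)" for b s p
  define g' where "g' b s p = \<phi> p * partial e (partial b u) (\<Phi> s p)
    + partial b \<phi> p * (partial e u (\<Phi> s p) + s * (\<phi> p * partial e (partial e u) (\<Phi> s p)))" for b s p
  have in_\<Omega>: "\<Phi> s p \<in> \<Omega>" if "s \<in> {-r..r}" "p \<in> cbox l m" for s p
    using stay[of s p] that assms(3) unfolding \<Phi>_def by auto
  have diff\<phi>: "\<phi> differentiable (at p)" for p using \<phi> by simp
  have partial\<Phi>: "partial b (\<lambda>q. u (\<Phi> s q)) p = g b s p"
    if "s \<in> {-r..r}" "p \<in> cbox l m" "b \<in> Basis" for b s p
  proof -
    let ?D = "frechet_derivative u (at (\<Phi> s p))" and ?d = "frechet_derivative \<phi> (at p)"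
    have "(\<Phi> s has_derivative (\<lambda>v. v + s *\<^sub>R (?d v *\<^sub>R e))) (at p)"
      unfolding \<Phi>_def using diff\<phi>[of p] unfolding frechet_derivative_works
      by (auto intro!: derivative_eq_intros)
    from has_derivative_compose[OF this, of u ?D] u2(1)[OF in_\<Omega>[OF that(1,2)]]
    have "partial b (\<lambda>q. u (\<Phi> s q)) p = ?D (b + s *\<^sub>R (?d b *\<^sub>R e))"
      by (intro partial_eqI[THEN trans]) (auto simp: frechet_derivative_works)
    also have "\<dots> = g b s p"
      using linear_frechet_derivative[OF u2(1)[OF in_\<Omega>[OF that(1,2)]]]
      by (simp add: linear_add linear_scale g_def partial_def)
    finally show ?thesis .
  qed
  have F: "(norm (grad (\<lambda>q. u (q + s *\<^sub>R (\<phi> q *\<^sub>R e))) p))\<^sup>2 = (\<Sum>b\<in>Basis. (g b s p)\<^sup>2)"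
    if "s \<in> {-r..r}" "p \<in> cbox l m" for s p
    using partial\<Phi>[OF that] unfolding norm_grad_sq \<Phi>_def[symmetric] by simp
  have cont\<phi>: "continuous_on T \<phi>" "continuous_on T (partial b \<phi>)" if "b \<in> Basis" for T b
    using \<phi> that diff\<phi> by (auto intro: differentiable_imp_continuous_on_open continuous_on_subset)
  let ?P = "{-r..r} \<times> cbox l m"
  have cont_fst: "continuous_on ?P (\<lambda>z. fst z)" by (intro continuous_intros)
  have cont\<phi>_snd: "continuous_on ?P (\<lambda>z. \<phi> (snd z))"
    by (rule continuous_on_compose2[OF cont\<phi>(1)[OF e, of UNIV]]) (auto intro: continuous_intros)
  have cont\<phi>'_snd: "continuous_on ?P (\<lambda>z. partial b \<phi> (snd z))" if "b \<in> Basis" for b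
    by (rule continuous_on_compose2[OF cont\<phi>(2)[OF that, of UNIV]]) (auto intro: continuous_intros)
  have cont\<Phi>: "continuous_on ?P (\<lambda>z. w (\<Phi> (fst z) (snd z)))" if "continuous_on \<Omega> w" for w :: "'a \<Rightarrow> real"
    using in_\<Omega> unfolding \<Phi>_def
    by (intro continuous_on_compose2[OF that] continuous_intros cont\<phi>_snd) auto
  have contu: "continuous_on \<Omega> (partial b u)" if "b \<in> Basis" for b
    using u2(2) that by (intro differentiable_imp_continuous_on_open)
  have cont_g: "continuous_on ?P (\<lambda>z. g b (fst z) (snd z))"
    and cont_g': "continuous_on ?P (\<lambda>z. g' b (fst z) (snd z))" if "b \<in> Basis" for b
    unfolding g_def g'_def
    by (intro continuous_intros cont\<Phi> contu u2(3) cont\<phi>_snd cont\<phi>'_snd cont_fst that e)+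
  have cont_slice: "continuous_on (cbox l m) (\<lambda>p. \<Sum>b\<in>Basis. (g b s p)\<^sup>2)" if "s \<in> {-r..r}" for s
  proof (intro continuous_intros)
    fix b :: 'a assume "b \<in> Basis"
    show "continuous_on (cbox l m) (g b s)"
      using continuous_on_compose2[OF cont_g[OF \<open>b \<in> Basis\<close>], of "cbox l m" "Pair s"] that
      by (simp add: continuous_on_Pair image_subset_iff)
  qed
  show "continuous_on (cbox l m) (\<lambda>p. (norm (grad (\<lambda>q. u (q + s *\<^sub>R (\<phi> q *\<^sub>R e))) p))\<^sup>2)"
    if "\<bar>s\<bar> \<le> r" for s
  proof -
    have "s \<in> {-r..r}" using that by auto
    then show ?thesis by (intro continuous_on_eq[OF cont_slice F[symmetric]])
  qed
  have "((\<lambda>s. integral (cbox l m) (\<lambda>p. \<Sum>b\<in>Basis. (g b s p)\<^sup>2)) has_real_derivative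
      integral (cbox l m) (\<lambda>p. \<Sum>b\<in>Basis. 2 * g b 0 p * g' b 0 p)) (at 0 within {-r..r})"
  proof (rule leibniz_rule_field_derivative)
    fix s p assume sp: "s \<in> {-r..r}" "p \<in> cbox l m"
    have D: "((\<lambda>s. partial b u (\<Phi> s p)) has_real_derivative \<phi> p * partial e (partial b u) (\<Phi> s p)) (at s)"
      if "b \<in> Basis" for b
      using u2(2)[OF in_\<Omega>[OF sp] that] unfolding \<Phi>_def by (rule has_real_derivative_line)
    have "((\<lambda>s. g b s p) has_real_derivative g' b s p) (at s)" if "b \<in> Basis" for b
      unfolding g_def g'_def
      by (auto intro!: derivative_eq_intros D[OF that] D[OF e] simp: algebra_simps)
    then have "((\<lambda>s. \<Sum>b\<in>Basis. (g b s p)\<^sup>2) has_real_derivative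
        (\<Sum>b\<in>Basis. 2 * g b s p * g' b s p)) (at s)"
      by (auto intro!: derivative_eq_intros sum.cong)
    then show "((\<lambda>s. \<Sum>b\<in>Basis. (g b s p)\<^sup>2) has_real_derivative
        (\<Sum>b\<in>Basis. 2 * g b s p * g' b s p)) (at s within {-r..r})"
      by (rule DERIV_subset) simp
  next
    show "(\<lambda>p. \<Sum>b\<in>Basis. (g b s p)\<^sup>2) integrable_on cbox l m" if "s \<in> {-r..r}" for s
      using cont_slice[OF that] by (rule integrable_continuous)
    show "continuous_on ?P (\<lambda>(s, p). \<Sum>b\<in>Basis. 2 * g b s p * g' b s p)"
      unfolding split_beta by (intro continuous_intros cont_g cont_g')
  qed (use \<open>0 < r\<close> in auto)
  then have "((\<lambda>s. integral (cbox l m) (\<lambda>p. \<Sum>b\<in>Basis. (g b s p)\<^sup>2)) has_real_derivative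
      integral (cbox l m) (\<lambda>p. \<Sum>b\<in>Basis. 2 * g b 0 p * g' b 0 p)) (at 0)"
    using at_within_interior[of 0 "{-r..r}"] \<open>0 < r\<close> by simp
  then have "((\<lambda>s. integral (cbox l m) (\<lambda>p. (norm (grad (\<lambda>q. u (q + s *\<^sub>R (\<phi> q *\<^sub>R e))) p))\<^sup>2))
      has_real_derivative integral (cbox l m) (\<lambda>p. \<Sum>b\<in>Basis. 2 * g b 0 p * g' b 0 p)) (at 0)"
    by (rule has_field_derivative_transform_within_open[of _ _ _ "{-r<..<r}"])
       (use \<open>0 < r\<close> F in \<open>auto intro!: integral_cong\<close>)
  then show "((\<lambda>s. integral (cbox l m) (\<lambda>p. (norm (grad (\<lambda>q. u (q + s *\<^sub>R (\<phi> q *\<^sub>R e))) p))\<^sup>2))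
      has_real_derivative integral (cbox l m) (\<lambda>p. \<Sum>b\<in>Basis. 2 * partial b u p *
        (\<phi> p * partial e (partial b u) p + partial b \<phi> p * partial e u p))) (at 0)"
    by (simp add: g_def g'_def \<Phi>_def)
qed

definition laplacian :: "('a::euclidean_space \<Rightarrow> real) \<Rightarrow> 'a \<Rightarrow> real" where
  "laplacian u p = (\<Sum>b\<in>Basis. partial b (partial b u) p)"

lemma continuous_on_laplacian: "Ck_on 2 u S \<Longrightarrow> continuous_on S (laplacian u)"
  unfolding laplacian_def[abs_def] by (intro continuous_intros Ck_on_2D(3)) auto

text \<open>The integrand of the first variation differs from \<open>- 2 \<phi> \<Delta>u \<partial>\<^sub>eu\<close> by the divergence of
  the field \<open>2 \<phi> \<partial>\<^sub>eu \<nabla>u\<close>.\<close>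

lemma first_variation_integral:
  fixes u \<phi> :: "'a::euclidean_space \<Rightarrow> real"
  assumes "open \<Omega>" "0 < r" "cball c (2 * r) \<subseteq> cbox l m" "cbox l m \<subseteq> \<Omega>" and e: "e \<in> Basis"
    and u: "Ck_on 2 u \<Omega>" and \<phi>: "Ck_on 1 \<phi> UNIV" "\<And>p. p \<notin> cball c r \<Longrightarrow> \<phi> p = 0"
  shows "integral (cbox l m) (\<lambda>p. \<Sum>b\<in>Basis. 2 * partial b u p *
            (\<phi> p * partial e (partial b u) p + partial b \<phi> p * partial e u p))
       = - 2 * integral (cbox l m) (\<lambda>p. \<phi> p * (laplacian u p * partial e u p))"
proof -
  note u2 = Ck_on_2D[OF u]
  let ?G = "\<lambda>b p. partial b u p * partial e u p"
  let ?V = "\<lambda>b p. partial b \<phi> p * ?G b p + \<phi> p * partial b (?G b) p"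
  have partialG: "partial b (?G b) p = partial b (partial b u) p * partial e u p
      + partial b u p * partial b (partial e u) p" if "b \<in> Basis" "p \<in> \<Omega>" for b p
    using that u2(2) e by (intro partial_mult)
  have contu: "continuous_on \<Omega> (partial b u)" if "b \<in> Basis" for b
    using u2(2) that by (intro differentiable_imp_continuous_on_open)
  have contG': "continuous_on \<Omega> (partial b (?G b))" if "b \<in> Basis" for b
  proof -
    have "continuous_on \<Omega> (\<lambda>p. partial b (partial b u) p * partial e u p
      + partial b u p * partial b (partial e u) p)"
      using that e by (intro continuous_intros contu u2(3))
    then show ?thesis using partialG[OF that] by (auto cong: continuous_on_cong)
  qed
  have diffG: "?G b differentiable (at p)" if "b \<in> Basis" "p \<in> \<Omega>" for b p
    using u2(2) that e by auto
  have cont\<phi>: "continuous_on T \<phi>" "continuous_on T (partial b \<phi>)" if "b \<in> Basis" for T b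
    using \<phi>(1) that by (auto intro: differentiable_imp_continuous_on_open continuous_on_subset)
  have contV: "continuous_on (cbox l m) (?V b)" if "b \<in> Basis" for b
    using that e by (intro continuous_intros cont\<phi>[OF that]
      contG'[THEN continuous_on_subset] contu[THEN continuous_on_subset] assms(4))
  have "integral (cbox l m) (\<lambda>p. \<Sum>b\<in>Basis. ?V b p) = (\<Sum>b\<in>Basis. integral (cbox l m) (?V b))"
    using contV by (intro integral_sum integrable_continuous) auto
  also have "\<dots> = 0"
    using assms(1-4) \<phi> diffG contG' by (intro sum.neutral ballI integral_partial_supported) auto
  finally have V: "integral (cbox l m) (\<lambda>p. \<Sum>b\<in>Basis. ?V b p) = 0" .
  have pointwise: "(\<Sum>b\<in>Basis. 2 * partial b u p *
      (\<phi> p * partial e (partial b u) p + partial b \<phi> p * partial e u p))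
    = 2 * (\<Sum>b\<in>Basis. ?V b p) + (- 2) * (\<phi> p * (laplacian u p * partial e u p))"
    if "p \<in> cbox l m" for p
  proof -
    have "p \<in> \<Omega>" using that assms(4) by blast
    \<comment> \<open>Integration by parts differentiates \<open>partial e u\<close> in direction
      \<open>b\<close>, the variation differentiates \<open>partial b u\<close> in direction
      \<open>e\<close>; symmetry identifies the two.\<close>
    have "2 * partial b u p * (\<phi> p * partial e (partial b u) p + partial b \<phi> p * partial e u p)
      = 2 * ?V b p + (- 2) * (\<phi> p * (partial b (partial b u) p * partial e u p))" if "b \<in> Basis" for b
      using partialG[OF that \<open>p \<in> \<Omega>\<close>] partial_commute[OF assms(1) \<open>p \<in> \<Omega>\<close> u e that]
      by (simp add: algebra_simps)
    then have "(\<Sum>b\<in>Basis. 2 * partial b u p *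
        (\<phi> p * partial e (partial b u) p + partial b \<phi> p * partial e u p))
      = (\<Sum>b\<in>Basis. 2 * ?V b p + (- 2) * (\<phi> p * (partial b (partial b u) p * partial e u p)))"
      by (intro sum.cong refl)
    then show ?thesis
      unfolding laplacian_def sum_distrib_left sum_distrib_right sum.distrib[symmetric]
      by (simp only: distrib_left)
  qed
  have int: "(\<lambda>p. \<phi> p * (laplacian u p * partial e u p)) integrable_on cbox l m"
    using e by (intro integrable_continuous continuous_intros cont\<phi>[OF e] assms(4)
      continuous_on_laplacian[OF u, THEN continuous_on_subset] contu[THEN continuous_on_subset])
  have "(\<lambda>p. \<Sum>b\<in>Basis. ?V b p) integrable_on cbox l m"
    using contV by (intro integrable_continuous continuous_on_sum)
  then have "integral (cbox l m) (\<lambda>p. 2 * (\<Sum>b\<in>Basis. ?V b p)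
      + (- 2) * (\<phi> p * (laplacian u p * partial e u p)))
    = integral (cbox l m) (\<lambda>p. 2 * (\<Sum>b\<in>Basis. ?V b p))
      + integral (cbox l m) (\<lambda>p. (- 2) * (\<phi> p * (laplacian u p * partial e u p)))"
    using int by (intro integral_add integrable_on_mult_right)
  also have "\<dots> = - 2 * integral (cbox l m) (\<lambda>p. \<phi> p * (laplacian u p * partial e u p))"
    using V by (simp only: integral_mult_right)
  finally have "integral (cbox l m) (\<lambda>p. 2 * (\<Sum>b\<in>Basis. ?V b p)
      + (- 2) * (\<phi> p * (laplacian u p * partial e u p)))
    = - 2 * integral (cbox l m) (\<lambda>p. \<phi> p * (laplacian u p * partial e u p))" .
  then show ?thesis
    using pointwise by (simp cong: integral_cong)
qed

text \<open>Fundamental lemma of the calculus of variations at one point: if \<open>G c\<close> were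
  nonzero, \<open>G\<close> would keep its sign on a small box around \<open>c\<close>, and a
  nonnegative bump positive at \<open>c\<close> would give a nonzero integral.\<close>

lemma continuous_eq_0_by_bumps:
  fixes G :: "'a::euclidean_space \<Rightarrow> real"
  assumes "open \<Omega>" "continuous_on \<Omega> G" "c \<in> \<Omega>"
    and bump: "\<And>r l m. 0 < r \<Longrightarrow> cball c (2 * r) \<subseteq> cbox l m \<Longrightarrow> cbox l m \<subseteq> \<Omega> \<Longrightarrow>
      integral (cbox l m) (\<lambda>p. bump c r p * G p) = 0"
  shows "G c = 0"
proof (rule ccontr)
  assume ne: "G c \<noteq> 0"
  \<comment> \<open>Multiplying by the constant \<open>G c\<close> treats both signs at
    once.\<close>
  let ?S = "\<Omega> \<inter> (\<lambda>p. G c * G p) -` {0<..}"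
  have "open ?S"
    using assms(1,2) by (intro continuous_open_preimage continuous_intros) auto
  moreover have "c \<in> ?S"
    using assms(3) ne by (auto simp: zero_less_mult_iff)
  ultimately obtain l m where lm: "cbox l m \<subseteq> ?S" "c \<in> box l m"
    using open_contains_cbox[of ?S c] by metis
  obtain \<rho> where \<rho>: "\<rho> > 0" "cball c \<rho> \<subseteq> box l m"
    using lm(2) open_contains_cball open_box by blast
  define r where "r = \<rho> / 2"
  have r: "r > 0" "cball c (2 * r) \<subseteq> cbox l m"
    using \<rho> box_subset_cbox unfolding r_def by auto
  have "integral (cbox l m) (\<lambda>p. bump c r p * G p) = 0"
    using bump[OF r] lm by blast
  then have "integral (cbox l m) (\<lambda>p. G c * (bump c r p * G p)) = 0"
    by simp
  moreover have "continuous_on (cbox l m) (\<lambda>p. G c * (bump c r p * G p))"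
    using Ck_on_bump[of 0 c r] lm assms(2)
    by (intro continuous_intros) (auto intro: continuous_on_subset)
  moreover have "G c * (bump c r p * G p) \<ge> 0" if "p \<in> cbox l m" for p
  proof -
    have "G c * G p > 0" using that lm(1) by auto
    then have "bump c r p * (G c * G p) \<ge> 0"
      by (intro mult_nonneg_nonneg[OF bump_bounds(1)]) simp
    then show ?thesis by (simp add: mult_ac)
  qed
  ultimately have "G c * (bump c r c * G c) = 0"
    using integral_cbox_eq_0_iff[of l m "\<lambda>p. G c * (bump c r p * G p)"] lm(2) box_subset_cbox by blast
  then show False
    using ne bump_center[OF r(1), of c] by simp
qed

text \<open>Criticality is used with a box as the set of finite energy: it is compact, contains the
  support of the field and is mapped into itself by each small variation. Its energy splits into one
  Dirichlet integral per component, so the first variation formula applies to each.\<close>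

lemma critical_on_imp_laplacian:
  fixes f :: "'a::euclidean_space \<Rightarrow> heis"
  assumes "open \<Omega>" "critical_on \<Omega> (zco f)" "Ck_on 2 (xco f) \<Omega>" "Ck_on 2 (yco f) \<Omega>"
    and e: "e \<in> Basis" and "c \<in> \<Omega>"
  shows "laplacian (xco f) c * partial e (xco f) c + laplacian (yco f) c * partial e (yco f) c = 0"
proof (rule continuous_eq_0_by_bumps[OF assms(1) _ \<open>c \<in> \<Omega>\<close>])
  have contu: "continuous_on \<Omega> (\<lambda>p. laplacian u p * partial e u p)" if "Ck_on 2 u \<Omega>" for u
    using Ck_on_2D[OF that] continuous_on_laplacian[OF that] e
    by (intro continuous_intros) (auto intro: differentiable_imp_continuous_on_open)
  show "continuous_on \<Omega> (\<lambda>c. laplacian (xco f) c * partial e (xco f) c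
      + laplacian (yco f) c * partial e (yco f) c)"
    by (intro continuous_on_add contu assms)
  fix r :: real and l m :: 'a
  assume r: "0 < r" and box: "cball c (2 * r) \<subseteq> cbox l m" "cbox l m \<subseteq> \<Omega>"
  let ?\<phi> = "bump c r" and ?\<xi> = "\<lambda>p. bump c r p *\<^sub>R e"
  let ?D = "\<lambda>u s p. (norm (grad (\<lambda>q. u (q + s *\<^sub>R ?\<xi> q)) p))\<^sup>2"
  let ?I = "\<lambda>u s. integral (cbox l m) (?D u s)"
  let ?L = "\<lambda>u. integral (cbox l m) (\<lambda>p. ?\<phi> p * (laplacian u p * partial e u p))"
  have \<phi>: "Ck_on 1 ?\<phi> UNIV" by (rule Ck_on_bump)
  \<comment> \<open>The bump is at most \<open>1\<close>, so points of \<open>cball c r\<close> move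
    by at most \<open>r\<close> and stay in \<open>cball c (2 * r)\<close>; all others are
    fixed.\<close>
  have stay: "p + s *\<^sub>R ?\<xi> p \<in> cbox l m" if "\<bar>s\<bar> \<le> r" "p \<in> cbox l m" for s p
  proof (cases "p \<in> cball c r")
    case True
    have "\<bar>s\<bar> * ?\<phi> p \<le> r * 1"
      using that r bump_bounds by (intro mult_mono) auto
    then have "p + s *\<^sub>R ?\<xi> p \<in> cball c (2 * r)"
      using True norm_triangle_ineq4[of "c - p" "s *\<^sub>R ?\<xi> p"] e bump_bounds[of c r p]
      by (auto simp: dist_norm algebra_simps abs_mult)
    then show ?thesis using box by blast
  next
    case False
    then show ?thesis using bump_eq_0[OF r False] that by simp
  qed
  have deriv: "(?I u has_real_derivative - 2 * ?L u) (at 0)"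
    and cont: "\<And>s. \<bar>s\<bar> \<le> r \<Longrightarrow> continuous_on (cbox l m) (?D u s)" if "Ck_on 2 u \<Omega>" for u
    using first_variation[OF assms(1) r box(2) e that \<phi> stay]
      first_variation_integral[OF assms(1) r box e that \<phi> bump_eq_0[OF r]]
    by auto
  have grad_sq: "grad_sq (\<lambda>p. zco f (p + s *\<^sub>R ?\<xi> p)) = (\<lambda>p. ?D (xco f) s p + ?D (yco f) s p)" for s
    by (simp add: grad_sq_def[abs_def] zco_def)
  have integrable: "set_integrable lebesgue (cbox l m) (grad_sq (\<lambda>p. zco f (p + s *\<^sub>R ?\<xi> p)))"
    if "\<bar>s\<bar> \<le> r" for s
    unfolding grad_sq
    using that assms(3,4) by (intro absolutely_integrable_continuous continuous_on_add cont)
  \<comment> \<open>\<open>energy\<close> is a Lebesgue integral, the variation formula a gauge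
    integral; absolute integrability makes them agree.\<close>
  have energy: "energy (cbox l m) (\<lambda>p. zco f (p + s *\<^sub>R ?\<xi> p)) = ?I (xco f) s + ?I (yco f) s"
    if "\<bar>s\<bar> \<le> r" for s
  proof -
    have "energy (cbox l m) (\<lambda>p. zco f (p + s *\<^sub>R ?\<xi> p))
        = integral (cbox l m) (\<lambda>p. ?D (xco f) s p + ?D (yco f) s p)"
      using set_lebesgue_integral_eq_integral(2)[OF integrable[OF that]]
      unfolding energy_def grad_sq .
    also have "\<dots> = ?I (xco f) s + ?I (yco f) s"
      using assms(3,4) that by (intro integral_add integrable_continuous cont)
    finally show ?thesis .
  qed
  have "cball c r \<subseteq> cbox l m" using box(1) r by force
  then have "test_field \<Omega> ?\<xi>" "supp ?\<xi> \<subseteq> cbox l m"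
    using test_field_bump[OF r, of c \<Omega> e] box by auto
  moreover have "set_integrable lebesgue (cbox l m) (grad_sq (zco f))"
    using integrable[of 0] r by simp
  ultimately have "test_field \<Omega> ?\<xi> \<and> cbox l m \<in> sets lebesgue \<and> supp ?\<xi> \<subseteq> cbox l m \<and> cbox l m \<subseteq> \<Omega>
      \<and> set_integrable lebesgue (cbox l m) (grad_sq (zco f))"
    using box(2) by (intro conjI) (simp_all only: lmeasurable_cbox fmeasurableD)
  then have "((\<lambda>s. energy (cbox l m) (\<lambda>p. zco f (p + s *\<^sub>R ?\<xi> p))) has_real_derivative 0) (at 0)"
    by (rule assms(2)[unfolded critical_on_def, THEN spec, THEN spec, THEN mp])
  then have "((\<lambda>s. ?I (xco f) s + ?I (yco f) s) has_real_derivative 0) (at 0)"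
    by (rule has_field_derivative_transform_within_open[of _ _ _ "{-r<..<r}"])
       (use r energy in auto)
  moreover have "((\<lambda>s. ?I (xco f) s + ?I (yco f) s) has_real_derivative
      (- 2 * ?L (xco f) + - 2 * ?L (yco f))) (at 0)"
    using assms(3,4) by (intro DERIV_add deriv)
  ultimately have "0 = - 2 * ?L (xco f) + - 2 * ?L (yco f)"
    by (rule DERIV_unique)
  then have "?L (xco f) + ?L (yco f) = 0"
    by linarith
  moreover have "(\<lambda>p. ?\<phi> p * (laplacian u p * partial e u p)) integrable_on cbox l m"
    if "Ck_on 2 u \<Omega>" for u
  proof (intro integrable_continuous continuous_on_mult[of _ ?\<phi>])
    show "continuous_on (cbox l m) ?\<phi>"
      using Ck_on_bump[of 0 c r] by (auto intro: continuous_on_subset)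
    show "continuous_on (cbox l m) (\<lambda>p. laplacian u p * partial e u p)"
      using contu[OF that] box(2) by (rule continuous_on_subset)
  qed
  ultimately show "integral (cbox l m) (\<lambda>p. ?\<phi> p * (laplacian (xco f) p * partial e (xco f) p
      + laplacian (yco f) p * partial e (yco f) p)) = 0"
    using assms(3,4) by (simp add: distrib_left integral_add)
qed


section \<open>Three spheres inequality for subharmonic functions\<close>

text \<open>If \<open>k\<close> were positive, \<open>g'\<close> would vanish at \<open>0\<close>
  and be positive just to the right, so the mean value theorem would push \<open>g\<close> above its
  maximum.\<close>

lemma second_derivative_nonpos_at_max:
  fixes g :: "real \<Rightarrow> real"
  assumes "\<delta> > 0" "\<And>s. \<bar>s\<bar> < \<delta> \<Longrightarrow> (g has_real_derivative g' s) (at s)"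
    and "(g' has_real_derivative k) (at 0)" "\<And>s. \<bar>s\<bar> < \<delta> \<Longrightarrow> g s \<le> g 0"
  shows "k \<le> 0"
proof (rule ccontr)
  assume "\<not> k \<le> 0"
  have "g' 0 = 0"
    using DERIV_local_max[of g "g' 0" 0 \<delta>] assms by simp
  then obtain d where d: "d > 0" "\<And>h. 0 < h \<Longrightarrow> h < d \<Longrightarrow> g' h > 0"
    using DERIV_pos_inc_right[OF assms(3)] \<open>\<not> k \<le> 0\<close> by auto
  define h where "h = min d \<delta> / 2"
  have h: "0 < h" "h < d" "h < \<delta>" using d(1) assms(1) by (auto simp: h_def min_def)
  obtain z where "0 < z" "z < h" "g h - g 0 = (h - 0) * g' z"
    using MVT2[OF h(1), of g g'] assms(2) h by auto
  then show False
    using d(2)[of z] h assms(4)[of h] by (smt (verit) mult_pos_pos)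
qed

lemma has_real_derivative_inner_line:
  fixes p b :: "'a::euclidean_space"
  assumes "b \<in> Basis"
  shows "((\<lambda>s. (p + s *\<^sub>R b) \<bullet> (p + s *\<^sub>R b)) has_real_derivative 2 * ((p + s *\<^sub>R b) \<bullet> b)) (at s)"
proof -
  have "(\<lambda>s. (p + s *\<^sub>R b) \<bullet> (p + s *\<^sub>R b)) = (\<lambda>s. p \<bullet> p + 2 * s * (p \<bullet> b) + s * s)"
    using assms by (auto simp: inner_add inner_commute algebra_simps)
  then show ?thesis
    using assms by (auto intro!: derivative_eq_intros simp: inner_add algebra_simps)
qed

lemma has_real_derivative_powr_line:
  fixes p b :: "'a::euclidean_space"
  assumes "b \<in> Basis" "p + s *\<^sub>R b \<noteq> 0"
  shows "((\<lambda>s. ((p + s *\<^sub>R b) \<bullet> (p + s *\<^sub>R b)) powr a) has_real_derivative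
    a * ((p + s *\<^sub>R b) \<bullet> (p + s *\<^sub>R b)) powr (a - 1) * (2 * ((p + s *\<^sub>R b) \<bullet> b))) (at s)"
  using assms
  by (intro DERIV_chain2[OF has_real_derivative_powr has_real_derivative_inner_line]) auto

text \<open>The comparison function is the radial solution \<open>\<alpha> + \<beta> |p|\<^bsup>2-n\<^esup>\<close>; the
  perturbation \<open>\<epsilon> |p|\<^sup>2\<close> makes the difference strictly subharmonic.\<close>

lemma subharmonic_le_radial:
  fixes u :: "'a::euclidean_space \<Rightarrow> real"
  assumes "open \<Omega>" "0 < r1" "{p. r1 \<le> norm p \<and> norm p \<le> r2} \<subseteq> \<Omega>"
    and u: "Ck_on 2 u \<Omega>" and sub: "\<And>p. p \<in> \<Omega> \<Longrightarrow> laplacian u p \<ge> 0"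
    and a: "a = (2 - real DIM('a)) / 2"
    and inner: "\<And>p. norm p = r1 \<Longrightarrow> u p \<le> \<alpha> + \<beta> * (p \<bullet> p) powr a"
    and outer: "\<And>p. norm p = r2 \<Longrightarrow> u p \<le> \<alpha> + \<beta> * (p \<bullet> p) powr a"
    and p: "r1 \<le> norm p" "norm p \<le> r2"
  shows "u p \<le> \<alpha> + \<beta> * (p \<bullet> p) powr a"
proof -
  note u2 = Ck_on_2D[OF u]
  let ?K = "{p::'a. r1 \<le> norm p \<and> norm p \<le> r2}"
  \<comment> \<open>Once an interior maximum is excluded, the perturbed difference is bounded by its
    values on the two spheres, which are at most \<open>\<epsilon> * r2\<^sup>2\<close>. Letting
    \<open>\<epsilon>\<close> tend to \<open>0\<close> finishes the proof.\<close>
  have bound: "u p - (\<alpha> + \<beta> * (p \<bullet> p) powr a) \<le> \<epsilon> * r2\<^sup>2" if \<epsilon>: "\<epsilon> > 0" for \<epsilon>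
  proof -
    \<comment> \<open>Writing \<open>|q|^(2 - n)\<close> as a power of \<open>q \<bullet> q\<close>
      keeps derivatives along lines free of square roots.\<close>
    define w where "w q = u q - (\<alpha> + \<beta> * (q \<bullet> q) powr a) + \<epsilon> * (q \<bullet> q)" for q
    define w' where "w' b q = partial b u q - \<beta> * (a * (q \<bullet> q) powr (a - 1) * (2 * (q \<bullet> b)))
      + \<epsilon> * (2 * (q \<bullet> b))" for b q
    have "?K = cball 0 r2 - ball 0 r1" by auto
    then have "compact ?K" by (simp add: compact_diff)
    moreover have "?K \<noteq> {}" using p by blast
    moreover have "continuous_on ?K w"
    proof -
      have "continuous_on ?K u"
        using u2(1) assms(3) by (intro differentiable_imp_continuous_on_open) auto
      moreover have "\<forall>q\<in>?K. q \<bullet> q \<noteq> 0" using assms(2) by auto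
      ultimately show ?thesis unfolding w_def by (intro continuous_intros)
    qed
    ultimately obtain q where q: "q \<in> ?K" and max: "\<And>q'. q' \<in> ?K \<Longrightarrow> w q' \<le> w q"
      using continuous_attains_sup[of ?K w] by metis
    have "norm q = r1 \<or> norm q = r2"
    proof (rule ccontr)
      assume "\<not> (norm q = r1 \<or> norm q = r2)"
      then have q': "q \<in> ball 0 r2 - cball 0 r1" using q by auto
      obtain \<delta> where \<delta>: "\<delta> > 0" "ball q \<delta> \<subseteq> ball 0 r2 - cball 0 r1"
        using q' openE[of "ball 0 r2 - cball (0::'a) r1" q] by (metis open_Diff open_ball closed_cball)
      have le: "partial b (partial b u) q - \<beta> * (a * ((a - 1) * (q \<bullet> q) powr (a - 2) * (2 * (q \<bullet> b)) * (2 * (q \<bullet> b))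
          + (q \<bullet> q) powr (a - 1) * 2)) + 2 * \<epsilon> \<le> 0" if b: "b \<in> Basis" for b
      proof (rule second_derivative_nonpos_at_max[OF \<delta>(1)])
        fix s :: real assume "\<bar>s\<bar> < \<delta>"
        then have "q + s *\<^sub>R b \<in> ball q \<delta>" using b by (simp add: dist_norm)
        then have s: "q + s *\<^sub>R b \<in> ?K" using \<delta>(2) by auto
        then show "w (q + s *\<^sub>R b) \<le> w (q + 0 *\<^sub>R b)" using max by simp
        have "q + s *\<^sub>R b \<noteq> 0" using s assms(2) by auto
        moreover have "((\<lambda>s. u (q + s *\<^sub>R b)) has_real_derivative partial b u (q + s *\<^sub>R b)) (at s)"
          using has_real_derivative_line[of u q s 1 b] u2(1) s assms(3) by auto
        ultimately show "((\<lambda>s. w (q + s *\<^sub>R b)) has_real_derivative w' b (q + s *\<^sub>R b)) (at s)"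
          unfolding w_def w'_def
          by (auto intro!: derivative_eq_intros has_real_derivative_powr_line[OF b]
                has_real_derivative_inner_line[OF b])
      next
        have "q + 0 *\<^sub>R b \<noteq> 0" using q assms(2) by auto
        note pw = has_real_derivative_powr_line[OF b this, of "a - 1"]
        have ib: "((\<lambda>s. 2 * ((q + s *\<^sub>R b) \<bullet> b)) has_real_derivative 2) (at 0)"
          using b by (auto intro!: derivative_eq_intros simp: inner_add)
        have "((\<lambda>s. partial b u (q + s *\<^sub>R b)) has_real_derivative partial b (partial b u) q) (at 0)"
          using has_real_derivative_line[of "partial b u" q 0 1 b] u2(2)[of q b] q assms(3) b by auto
        from DERIV_add[OF DERIV_diff[OF this
            DERIV_cmult[OF DERIV_cmult[OF DERIV_mult[OF pw ib], of a], of \<beta>]]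
            DERIV_cmult[OF ib, of \<epsilon>]]
        show "((\<lambda>s. w' b (q + s *\<^sub>R b)) has_real_derivative partial b (partial b u) q
          - \<beta> * (a * ((a - 1) * (q \<bullet> q) powr (a - 2) * (2 * (q \<bullet> b)) * (2 * (q \<bullet> b))
          + (q \<bullet> q) powr (a - 1) * 2)) + 2 * \<epsilon>) (at 0)"
          unfolding w'_def by (simp add: mult_ac add_ac diff_diff_eq)
      qed
      \<comment> \<open>Harmonicity of the radial term, up to the factor \<open>\<beta> * a\<close>:
        the sum over the directions is \<open>(4 * (a - 1) + 2 * n) * ?R powr (a - 1)\<close>, which
        vanishes because \<open>n = 2 - 2 * a\<close>.\<close>
      let ?R = "q \<bullet> q"
      have R: "?R > 0" using q assms(2) by auto
      have "(\<Sum>b\<in>Basis. (q \<bullet> b) * (q \<bullet> b)) = ?R"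
        by (simp add: euclidean_inner[of q q])
      then have "4 * (a - 1) * (?R powr (a - 2) * ?R) + 2 * real DIM('a) * ?R powr (a - 1)
          = (\<Sum>b\<in>Basis. 4 * (a - 1) * (?R powr (a - 2) * ((q \<bullet> b) * (q \<bullet> b))) + ?R powr (a - 1) * 2)"
        by (simp add: sum.distrib sum_distrib_left[symmetric])
      then have "(\<Sum>b\<in>Basis. (a - 1) * ?R powr (a - 2) * (2 * (q \<bullet> b)) * (2 * (q \<bullet> b)) + ?R powr (a - 1) * 2)
          = 4 * (a - 1) * (?R powr (a - 2) * ?R) + 2 * real DIM('a) * ?R powr (a - 1)"
        by (simp add: algebra_simps)
      also have "?R powr (a - 2) * ?R = ?R powr (a - 1)"
        using powr_mult_base[of ?R "a - 2"] R by (simp add: mult.commute)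
      also have "real DIM('a) = 2 - 2 * a"
        using a by simp
      also have "4 * (a - 1) * ?R powr (a - 1) + 2 * (2 - 2 * a) * ?R powr (a - 1) = 0"
        by (simp add: algebra_simps)
      finally have harm: "(\<Sum>b\<in>Basis. (a - 1) * ?R powr (a - 2) * (2 * (q \<bullet> b)) * (2 * (q \<bullet> b))
          + ?R powr (a - 1) * 2) = 0" .
      have "(\<Sum>b\<in>Basis. partial b (partial b u) q - \<beta> * (a * ((a - 1) * ?R powr (a - 2) * (2 * (q \<bullet> b)) * (2 * (q \<bullet> b))
          + ?R powr (a - 1) * 2)) + 2 * \<epsilon>) \<le> 0"
        using le by (intro sum_nonpos)
      then have "laplacian u q + 2 * \<epsilon> * real DIM('a) \<le> 0"
        using harm by (simp add: sum.distrib sum_subtractf sum_distrib_left[symmetric] laplacian_def mult_ac)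
      moreover have "laplacian u q \<ge> 0" using sub q assms(3) by blast
      moreover have "2 * \<epsilon> * real DIM('a) > 0" using \<epsilon> by simp
      ultimately show False by linarith
    qed
    moreover have "w q \<le> \<epsilon> * r2\<^sup>2"
    proof -
      have "u q \<le> \<alpha> + \<beta> * (q \<bullet> q) powr a" using calculation inner outer by blast
      moreover have "q \<bullet> q \<le> r2\<^sup>2"
        using q power_mono[of "norm q" r2 2] by (simp add: power2_norm_eq_inner)
      then have "\<epsilon> * (q \<bullet> q) \<le> \<epsilon> * r2\<^sup>2"
        using \<epsilon> by (intro mult_left_mono) auto
      ultimately show ?thesis
        unfolding w_def by linarith
    qed
    moreover have "w p \<le> w q" using max p by simp
    moreover have "\<epsilon> * (p \<bullet> p) \<ge> 0" using \<epsilon> by simp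
    ultimately show ?thesis by (simp add: w_def)
  qed
  have "u p - (\<alpha> + \<beta> * (p \<bullet> p) powr a) \<le> 0 + \<eta>" if "\<eta> > 0" for \<eta>
  proof -
    have "r2 > 0" using p assms(2) by linarith
    then show ?thesis
      using bound[of "\<eta> / r2\<^sup>2"] that by simp
  qed
  then show ?thesis
    using field_le_epsilon[of "u p - (\<alpha> + \<beta> * (p \<bullet> p) powr a)" 0] by simp
qed

text \<open>The coefficients \<open>\<alpha>\<close> and \<open>\<beta>\<close> solve the two
  boundary conditions, and the right side of the inequality is the resulting radial function at
  radius \<open>r\<close>. The system is solvable because the exponent \<open>e\<close> is
  nonzero.\<close>

lemma three_spheres_subharmonic:
  fixes u :: "'a::euclidean_space \<Rightarrow> real"
  assumes "DIM('a) \<noteq> 2" "open \<Omega>" "0 < r1" "r1 < r" "r < r2"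
    and "{p. r1 \<le> norm p \<and> norm p \<le> r2} \<subseteq> \<Omega>"
    and u: "Ck_on 2 u \<Omega>" and sub: "\<And>p. p \<in> \<Omega> \<Longrightarrow> laplacian u p \<ge> 0"
  shows "three_spheres_ineq u r1 r r2"
proof -
  define e where "e = 2 - int DIM('a)"
  define a where "a = (2 - real DIM('a)) / 2"
  let ?M = "sphere_sup u"
  have "e \<noteq> 0" using assms(1) by (simp add: e_def)
  have powi: "(p \<bullet> p) powr a = \<rho> powi e" if "norm p = \<rho>" "\<rho> > 0" for p :: 'a and \<rho>
  proof -
    have "p \<bullet> p = \<rho> powr 2"
      using that powr_realpow[of \<rho> 2] by (simp add: dot_square_norm)
    then have "(p \<bullet> p) powr a = \<rho> powr (2 * a)"
      by (simp add: powr_powr)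
    also have "2 * a = real_of_int e"
      by (simp add: a_def e_def)
    finally have "(p \<bullet> p) powr a = \<rho> powr real_of_int e" .
    then show ?thesis using that(2) by (simp add: powr_real_of_int')
  qed
  have ne: "r1 powi e \<noteq> r2 powi e"
  proof
    assume "r1 powi e = r2 powi e"
    then have "r1 powr real_of_int e = r2 powr real_of_int e"
      using assms(3-5) by (simp add: powr_real_of_int')
    then have "ln (r1 powr real_of_int e) = ln (r2 powr real_of_int e)"
      by simp
    then have "real_of_int e * ln r1 = real_of_int e * ln r2"
      using assms(3-5) by (simp add: ln_powr)
    then show False using \<open>e \<noteq> 0\<close> assms(3-5) by simp
  qed
  define \<beta> where "\<beta> = (?M r1 - ?M r2) / (r1 powi e - r2 powi e)"
  define \<alpha> where "\<alpha> = ?M r1 - \<beta> * r1 powi e"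
  have \<beta>: "\<beta> * (r1 powi e - r2 powi e) = ?M r1 - ?M r2"
    using ne by (simp add: \<beta>_def)
  have bdry: "\<alpha> + \<beta> * r1 powi e = ?M r1" "\<alpha> + \<beta> * r2 powi e = ?M r2"
    using \<beta> by (auto simp: \<alpha>_def algebra_simps)
  \<comment> \<open>A real \<open>SUP\<close> is an upper bound only of a set that is bounded above;
    continuity on the compact sphere supplies this.\<close>
  have le_sup: "u p \<le> ?M \<rho>" if "norm p = \<rho>" "r1 \<le> \<rho>" "\<rho> \<le> r2" for p \<rho>
  proof -
    have "sphere 0 \<rho> \<subseteq> \<Omega>" using that assms(6) by auto
    then have "continuous_on (sphere 0 \<rho>) u"
      using Ck_on_2D(1)[OF u] by (intro differentiable_imp_continuous_on_open) auto
    then have "bdd_above (u ` sphere 0 \<rho>)"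
      by (intro compact_imp_bounded bounded_imp_bdd_above compact_continuous_image) auto
    then show ?thesis
      unfolding sphere_sup_def using that by (intro cSUP_upper) auto
  qed
  have le: "u p \<le> \<alpha> + \<beta> * r powi e" if "p \<in> sphere 0 r" for p
  proof -
    have "u p \<le> \<alpha> + \<beta> * (p \<bullet> p) powr a"
    proof (rule subharmonic_le_radial[OF assms(2,3,6) u sub a_def])
      show "u q \<le> \<alpha> + \<beta> * (q \<bullet> q) powr a" if "norm q = r1" for q
        using le_sup[OF that] powi[OF that] bdry assms(3-5) by simp
      show "u q \<le> \<alpha> + \<beta> * (q \<bullet> q) powr a" if "norm q = r2" for q
        using le_sup[OF that] powi[OF that] bdry assms(3-5) by simp
    qed (use that assms(3-5) in auto)
    then show ?thesis using powi[of p r] that assms(3,4) by simp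
  qed
  have "?M r \<le> \<alpha> + \<beta> * r powi e"
    unfolding sphere_sup_def[of u r]
  proof (rule cSUP_least[OF _ le])
    show "sphere (0::'a) r \<noteq> {}" using assms(3,4) by simp
  qed
  also have "\<dots> = ?M r1 * ((r powi e - r2 powi e) / (r1 powi e - r2 powi e))
          + ?M r2 * ((r1 powi e - r powi e) / (r1 powi e - r2 powi e))"
    using ne unfolding \<alpha>_def \<beta>_def by (simp add: field_simps)
  finally show ?thesis
    unfolding three_spheres_ineq_def Let_def e_def .
qed

section \<open>Laplacians of the coordinates of a harmonic curve\<close>

text \<open>\<open>1\<close> is the only basis vector of \<open>real\<close>, so the partial
  derivatives in \<open>Ck_on\<close> become \<open>deriv\<close>.\<close>

lemma Ck_on_2_real:
  fixes H :: "real \<Rightarrow> real"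
  assumes "Ck_on 2 H UNIV"
  shows "(H has_real_derivative deriv H s) (at s)"
    and "(deriv H has_real_derivative deriv (deriv H) s) (at s)"
    and "continuous_on UNIV (deriv (deriv H))"
proof -
  have partial: "partial 1 g = deriv g \<and> (g has_real_derivative deriv g s) (at s)"
    if "\<And>s. g differentiable (at s)" for g :: "real \<Rightarrow> real" and s
  proof -
    have D: "(g has_real_derivative deriv g s) (at s)" for s
      using that by (metis DERIV_deriv_iff_real_differentiable)
    have "partial 1 g s = deriv g s" for s
      using partial_eqI[OF D[unfolded has_field_derivative_def], of 1] by simp
    then show ?thesis using D by auto
  qed
  note H = Ck_on_2D[OF assms]
  have 1: "partial 1 H = deriv H" using partial H(1) by auto
  have 2: "partial 1 (deriv H) = deriv (deriv H)" using partial H(2)[of _ 1] 1 by auto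
  show "(H has_real_derivative deriv H s) (at s)"
    using partial H(1) by auto
  show "(deriv H has_real_derivative deriv (deriv H) s) (at s)"
    using partial H(2)[of _ 1] 1 by auto
  show "continuous_on UNIV (deriv (deriv H))"
    using H(3)[of 1 1] 1 2 by simp
qed

lemma partial_compose_real:
  fixes y :: "'a::euclidean_space \<Rightarrow> real"
  assumes "(H has_real_derivative d) (at (y p))" "y differentiable (at p)"
  shows "partial b (\<lambda>q. H (y q)) p = d * partial b y p"
    and "(\<lambda>q. H (y q)) differentiable (at p)"
proof -
  have D: "((\<lambda>q. H (y q)) has_derivative (\<lambda>v. d * frechet_derivative y (at p) v)) (at p)"
    using has_derivative_compose[of y "frechet_derivative y (at p)" p UNIV H "(*) d"] assms
    by (simp add: frechet_derivative_works has_field_derivative_def)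
  show "partial b (\<lambda>q. H (y q)) p = d * partial b y p"
    using partial_eqI[OF D] by (simp add: partial_def)
  show "(\<lambda>q. H (y q)) differentiable (at p)"
    using D unfolding differentiable_def by blast
qed

lemma partial_diff:
  fixes u v :: "'a::euclidean_space \<Rightarrow> real"
  assumes "u differentiable (at p)" "v differentiable (at p)"
  shows "partial b (\<lambda>q. u q - v q) p = partial b u p - partial b v p"
  using assms unfolding frechet_derivative_works
  by (intro partial_eqI[THEN trans, OF has_derivative_diff]) (auto simp: partial_def)

definition grad_norm2 :: "('a::euclidean_space \<Rightarrow> real) \<Rightarrow> 'a \<Rightarrow> real" where
  "grad_norm2 u p = (\<Sum>b\<in>Basis. (partial b u p)\<^sup>2)"

lemma laplacian_compose:
  fixes y :: "'a::euclidean_space \<Rightarrow> real"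
  assumes "open \<Omega>" "p \<in> \<Omega>" and H: "Ck_on 2 H UNIV" and y: "Ck_on 2 y \<Omega>"
    and x: "\<And>q. q \<in> \<Omega> \<Longrightarrow> x q = H (y q)"
  shows "\<And>b. partial b x p = deriv H (y p) * partial b y p"
    and "laplacian x p = deriv (deriv H) (y p) * grad_norm2 y p + deriv H (y p) * laplacian y p"
proof -
  note y2 = Ck_on_2D[OF y] and H2 = Ck_on_2_real[OF H]
  \<comment> \<open>Established on all of \<open>\<Omega>\<close> and not only at \<open>p\<close>,
    since this formula is differentiated once more.\<close>
  have x1: "partial b x q = deriv H (y q) * partial b y q" if "q \<in> \<Omega>" for b q
    using partial_cong_open[of \<Omega> q "\<lambda>q. H (y q)" x b] partial_compose_real[OF H2(1) y2(1), of q]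
      assms(1) that x by metis
  then show "\<And>b. partial b x p = deriv H (y p) * partial b y p" using assms(2) .
  have "partial b (partial b x) p = deriv (deriv H) (y p) * (partial b y p)\<^sup>2
      + deriv H (y p) * partial b (partial b y) p" if "b \<in> Basis" for b
  proof -
    note D = partial_compose_real[OF H2(2) y2(1)[OF assms(2)]]
    have "partial b (partial b x) p = partial b (\<lambda>q. deriv H (y q) * partial b y q) p"
      using D y2(2)[OF assms(2) that] assms(1,2) x1
      by (intro partial_cong_open[symmetric, of \<Omega>]) auto
    also have "\<dots> = deriv (deriv H) (y p) * (partial b y p)\<^sup>2 + deriv H (y p) * partial b (partial b y) p"
      using partial_mult[OF D(2) y2(2)[OF assms(2) that]] D(1) by (simp add: power2_eq_square)
    finally show ?thesis .
  qed
  then show "laplacian x p = deriv (deriv H) (y p) * grad_norm2 y p + deriv H (y p) * laplacian y p"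
    by (simp add: laplacian_def grad_norm2_def sum.distrib sum_distrib_left)
qed

text \<open>Where \<open>\<nabla>y \<noteq> 0\<close>, the equation is \<open>\<Delta>x \<nabla>x + \<Delta>y \<nabla>y = 0\<close> divided by \<open>\<nabla>y\<close>. In the
  interior of the set \<open>\<nabla>y = 0\<close> both sides vanish, and the remaining points are
  limits of points with \<open>\<nabla>y \<noteq> 0\<close>.\<close>

lemma harmonic_curve_equation:
  fixes f :: "'a::euclidean_space \<Rightarrow> heis"
  assumes "open \<Omega>" "p \<in> \<Omega>" "critical_on \<Omega> (zco f)"
    and H: "Ck_on 2 H UNIV" and x: "Ck_on 2 (xco f) \<Omega>" and y: "Ck_on 2 (yco f) \<Omega>"
    and comp: "\<And>q. q \<in> \<Omega> \<Longrightarrow> xco f q = H (yco f q)"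
  shows "(1 + (deriv H (yco f p))\<^sup>2) * laplacian (yco f) p
    = - (deriv H (yco f p) * deriv (deriv H) (yco f p) * grad_norm2 (yco f) p)"
proof -
  let ?y = "yco f"
  note y2 = Ck_on_2D[OF y] and H2 = Ck_on_2_real[OF H]
  define Q where "Q q = (1 + (deriv H (?y q))\<^sup>2) * laplacian ?y q
    + deriv H (?y q) * deriv (deriv H) (?y q) * grad_norm2 ?y q" for q
  \<comment> \<open>With the chain rule for \<open>x\<close>, the vanishing combination of
    Laplacians factors as \<open>(\<Delta>x * H' + \<Delta>y) * partial e ?y q\<close>, and the
    bracket is \<open>Q\<close>.\<close>
  have Q: "Q q * partial e ?y q = 0" if "q \<in> \<Omega>" "e \<in> Basis" for q e
    using critical_on_imp_laplacian[OF assms(1,3) x y that(2,1)]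
      laplacian_compose[OF assms(1) that(1) H y comp]
    by (simp add: Q_def algebra_simps power2_eq_square)
  have conty: "continuous_on \<Omega> ?y"
    using y2(1) by (intro differentiable_imp_continuous_on_open)
  have "continuous_on UNIV (deriv H)"
    using H2(2) DERIV_isCont continuous_at_imp_continuous_on by blast
  then have "continuous_on \<Omega> (\<lambda>q. deriv H (?y q))"
    "continuous_on \<Omega> (\<lambda>q. deriv (deriv H) (?y q))"
    using continuous_on_compose2[OF _ conty] H2(3) by auto
  moreover have "continuous_on \<Omega> (grad_norm2 ?y)"
    unfolding grad_norm2_def[abs_def] using y2(2)
    by (intro continuous_intros) (auto intro: differentiable_imp_continuous_on_open)
  ultimately have "continuous_on \<Omega> Q"
    unfolding Q_def using continuous_on_laplacian[OF y] by (intro continuous_intros)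
  then have "open (\<Omega> \<inter> Q -` (- {0}))"
    using assms(1) by (intro continuous_open_preimage) auto
  \<comment> \<open>The open set where \<open>Q\<close> is nonzero handles the degenerate points at
    once: the gradient of \<open>y\<close> vanishes throughout it, hence so do the pure second
    derivatives, and these make \<open>Q\<close> zero.\<close>
  moreover define N where "N = \<Omega> \<inter> Q -` (- {0})"
  ultimately have "open N" by simp
  have "Q p = 0"
  proof (rule ccontr)
    assume "Q p \<noteq> 0"
    then have "p \<in> N" using assms(2) by (simp add: N_def)
    have zero: "partial e ?y q = 0" if "q \<in> N" "e \<in> Basis" for q e
      using Q[of q e] that by (auto simp: N_def)
    have "partial b (partial b ?y) p = 0" if "b \<in> Basis" for b
    proof -
      have "partial b (partial b ?y) p = partial b (\<lambda>_. 0) p"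
        using zero that \<open>open N\<close> \<open>p \<in> N\<close> y2(2)[OF assms(2)] by (intro partial_cong_open[of N]) auto
      then show ?thesis by (simp add: partial_def)
    qed
    then have "Q p = 0"
      using zero[OF \<open>p \<in> N\<close>] by (simp add: Q_def laplacian_def grad_norm2_def)
    then show False using \<open>Q p \<noteq> 0\<close> by simp
  qed
  then show ?thesis by (simp add: Q_def)
qed

text \<open>In the divergence of the contact equation the first-order products of the gradients of
  \<open>x\<close> and \<open>y\<close> cancel, leaving only second derivatives.\<close>

lemma laplacian_contact:
  fixes f :: "'a::euclidean_space \<Rightarrow> heis"
  assumes "open \<Omega>" "p \<in> \<Omega>" "contact_on \<Omega> f"
    and x: "Ck_on 2 (xco f) \<Omega>" and y: "Ck_on 2 (yco f) \<Omega>" and t: "Ck_on 2 (tco f) \<Omega>"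
  shows "laplacian (tco f) p = 2 * (yco f p * laplacian (xco f) p - xco f p * laplacian (yco f) p)"
proof -
  let ?x = "xco f" and ?y = "yco f"
  note x2 = Ck_on_2D[OF x] and y2 = Ck_on_2D[OF y] and t2 = Ck_on_2D[OF t]
  have grad: "grad u q \<bullet> b = partial b u q" if "b \<in> Basis" for b q and u :: "'a \<Rightarrow> real"
    using that unfolding grad_def by (rule inner_sum_left_Basis)
  have t1: "partial b (tco f) q = 2 * (?y q * partial b ?x q) - 2 * (?x q * partial b ?y q)"
    if "q \<in> \<Omega>" "b \<in> Basis" for b q
  proof -
    have "grad (tco f) q \<bullet> b = (2 *\<^sub>R (?y q *\<^sub>R grad ?x q - ?x q *\<^sub>R grad ?y q)) \<bullet> b"
      using assms(3) that(1) unfolding contact_on_def by simp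
    then show ?thesis
      by (simp add: grad[OF that(2)] inner_diff_left)
  qed
  have "partial b (partial b (tco f)) p
      = 2 * (?y p * partial b (partial b ?x) p - ?x p * partial b (partial b ?y) p)"
    if b: "b \<in> Basis" for b
  proof -
    note d = x2(1)[OF assms(2)] y2(1)[OF assms(2)] x2(2)[OF assms(2) b] y2(2)[OF assms(2) b]
    have c: "partial b (\<lambda>_. 2 :: real) p = 0"
      by (simp add: partial_def)
    have "partial b (partial b (tco f)) p
        = partial b (\<lambda>q. 2 * (?y q * partial b ?x q) - 2 * (?x q * partial b ?y q)) p"
      using partial_cong_open[OF assms(1,2) t1[OF _ b] t2(2)[OF assms(2) b]] by blast
    also have "\<dots> = 2 * (?y p * partial b (partial b ?x) p - ?x p * partial b (partial b ?y) p)"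
      using d by (simp add: partial_diff partial_mult c algebra_simps)
    finally show ?thesis .
  qed
  then show ?thesis
    by (simp add: laplacian_def sum_distrib_left sum_subtractf right_diff_distrib)
qed

theorem proposition4p13:
  fixes \<Omega> :: "'a::euclidean_space set"
    and f :: "'a \<Rightarrow> heis"
    and H :: "real \<Rightarrow> real"
    and r\<^sub>1 r\<^sub>2 :: real
  assumes "DIM('a) \<noteq> 2"
    and "open \<Omega>" and "connected \<Omega>" and "\<Omega> \<noteq> {}"
    and "harmonic_map \<Omega> f"
    and "Ck_on 2 H UNIV"
    and "\<forall>p\<in>\<Omega>. xco f p = H (yco f p)"
    and "0 < r\<^sub>1" and "r\<^sub>1 < r\<^sub>2"
    and "{p. r\<^sub>1 \<le> norm p \<and> norm p \<le> r\<^sub>2} \<subseteq> \<Omega>"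
  shows "((\<forall>s. deriv H s * deriv (deriv H) s \<le> 0) \<longrightarrow>
            (\<forall>r. r\<^sub>1 < r \<and> r < r\<^sub>2 \<longrightarrow> three_spheres_ineq (yco f) r\<^sub>1 r r\<^sub>2)) \<and>
         ((\<forall>s. deriv (deriv H) s \<ge> 0) \<longrightarrow>
            (\<forall>r. r\<^sub>1 < r \<and> r < r\<^sub>2 \<longrightarrow> three_spheres_ineq (xco f) r\<^sub>1 r r\<^sub>2)) \<and>
         ((\<forall>s. (s + H s * deriv H s) * deriv (deriv H) s \<ge> 0) \<longrightarrow>
            (\<forall>r. r\<^sub>1 < r \<and> r < r\<^sub>2 \<longrightarrow> three_spheres_ineq (tco f) r\<^sub>1 r r\<^sub>2))"
proof -
  have f: "Ck_on 2 f \<Omega>" "contact_on \<Omega> f" "critical_on \<Omega> (zco f)"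
    using assms(5) by (auto simp: harmonic_map_def)
  have comp: "xco f p = H (yco f p)" if "p \<in> \<Omega>" for p
    using assms(7) that by blast
  have C2: "Ck_on 2 (xco f) \<Omega>" "Ck_on 2 (yco f) \<Omega>" "Ck_on 2 (tco f) \<Omega>"
    unfolding xco_def[abs_def] yco_def[abs_def] tco_def[abs_def]
    by (intro Ck_on_bounded_linear[OF assms(2) bounded_linear_vec_nth f(1)])+
  let ?h = "\<lambda>p. deriv H (yco f p)" and ?k = "\<lambda>p. deriv (deriv H) (yco f p)"
    and ?g = "grad_norm2 (yco f)"
  \<comment> \<open>All three identities below stay multiplied by this positive factor, so the sign
    of each Laplacian is read off without division.\<close>
  have pos: "1 + (?h p)\<^sup>2 > 0" for p
    by (simp add: add_pos_nonneg)
  have g: "?g p \<ge> 0" for p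
    by (simp add: grad_norm2_def sum_nonneg)
  have y: "(1 + (?h p)\<^sup>2) * laplacian (yco f) p = - (?h p * ?k p) * ?g p" if "p \<in> \<Omega>" for p
    using harmonic_curve_equation[OF assms(2) that f(3) assms(6) C2(1,2) comp] by simp
  have x: "(1 + (?h p)\<^sup>2) * laplacian (xco f) p = ?k p * ?g p" if "p \<in> \<Omega>" for p
  proof -
    \<comment> \<open>Inserting the equation for \<open>y\<close> cancels the term
      \<open>(?h p)\<^sup>2 * ?k p * ?g p\<close>.\<close>
    have "(1 + (?h p)\<^sup>2) * laplacian (xco f) p
        = (1 + (?h p)\<^sup>2) * (?k p * ?g p) + ?h p * ((1 + (?h p)\<^sup>2) * laplacian (yco f) p)"
      using laplacian_compose(2)[OF assms(2) that assms(6) C2(2) comp] by (simp add: algebra_simps)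
    then show ?thesis
      unfolding y[OF that] by (simp add: algebra_simps power2_eq_square)
  qed
  \<comment> \<open>Both Laplacians on the right carry the factor \<open>?k p * ?g p\<close>; what
    remains, with \<open>H (yco f p)\<close> for \<open>xco f p\<close>, is the expression
    \<open>s + H s * deriv H s\<close> at \<open>s = yco f p\<close>.\<close>
  have t: "(1 + (?h p)\<^sup>2) * laplacian (tco f) p
      = 2 * ((yco f p + H (yco f p) * ?h p) * ?k p) * ?g p" if "p \<in> \<Omega>" for p
  proof -
    have "(1 + (?h p)\<^sup>2) * laplacian (tco f) p
        = 2 * (yco f p * ((1 + (?h p)\<^sup>2) * laplacian (xco f) p)
             - xco f p * ((1 + (?h p)\<^sup>2) * laplacian (yco f) p))"
      unfolding laplacian_contact[OF assms(2) that f(2) C2] by (simp add: algebra_simps)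
    then show ?thesis
      unfolding x[OF that] y[OF that] comp[OF that] by (simp add: algebra_simps)
  qed
  have nonneg: "v \<ge> 0" if "(1 + (?h p)\<^sup>2) * v \<ge> 0" for v p
    using that pos[of p] by (simp add: zero_le_mult_iff)
  have spheres: "three_spheres_ineq u r\<^sub>1 r r\<^sub>2"
    if "Ck_on 2 u \<Omega>" "\<And>p. p \<in> \<Omega> \<Longrightarrow> (1 + (?h p)\<^sup>2) * laplacian u p \<ge> 0" "r\<^sub>1 < r" "r < r\<^sub>2" for u r
    using three_spheres_subharmonic[OF assms(1,2,8) that(3,4) assms(10) that(1) nonneg[OF that(2)]] .
  show ?thesis
  proof (intro conjI impI allI)
    fix r assume "\<forall>s. deriv H s * deriv (deriv H) s \<le> 0" "r\<^sub>1 < r \<and> r < r\<^sub>2"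
    then show "three_spheres_ineq (yco f) r\<^sub>1 r r\<^sub>2"
      using y g C2 by (intro spheres) (auto intro: mult_nonpos_nonneg)
  next
    fix r assume "\<forall>s. deriv (deriv H) s \<ge> 0" "r\<^sub>1 < r \<and> r < r\<^sub>2"
    then show "three_spheres_ineq (xco f) r\<^sub>1 r r\<^sub>2"
      using x g C2 by (intro spheres) auto
  next
    fix r assume "\<forall>s. (s + H s * deriv H s) * deriv (deriv H) s \<ge> 0" "r\<^sub>1 < r \<and> r < r\<^sub>2"
    then show "three_spheres_ineq (tco f) r\<^sub>1 r r\<^sub>2"
      using t g C2 by (intro spheres) auto
  qed
qed

end
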